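(* Let $t\not\equiv 0\pmod 4$ be a fixed positive integer and let $n$ and $k<n$ be positive integers such that $t\mid 2nk$ and such that one of the following holds: (1) $nk$ is odd, $n\geq k\geq 3$, and $\gcd(n,k-1)=1$; (2) $nk$ is odd, $n\geq k$, and $3<k<200$; (3) $nk$ is odd, $n\geq k\geq 3$, and $n\geq (k-2)(k-1)$. Then the number of non-isomorphic biembeddings $\Pi$ of $K_{\frac{2nk+t}{t}\times t}$ such that (a) $\mathrm{Aut}(\Pi)=\mathbb{Z}_{2nk+t}$, (b) the faces determined by $\Pi$ have lengths multiples of $k$, is, setting $v=2nk+t$, at least $$\left(1-O\left(\tfrac{1}{nk}\right)\right)\frac{(nk)!}{2\phi(2nk+t)}=(1-o(1))\frac{\left(\frac{v-t}{2}\right)!}{2\phi(v)}.$$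
   Context: $\phi(\cdot)$ is Euler's totient function. Asymptotic convention: $t$ is fixed, the constant implied in $O(\cdot)$ depends only on $t$, and $o(1)$ is for $nk\to\infty$. $K_{\frac{v}{t}\times t}$ is the complete multipartite graph with $v/t$ parts of size $t$; its vertex set is identified with $\mathbb{Z}_v$, two vertices being adjacent iff their difference is not in the subgroup $J=\frac{v}{t}\mathbb{Z}_v$ of order $t$. A (combinatorial, orientable) embedding of a connected graph $\Gamma$ is a pair $\Pi=(\Gamma,\rho)$ where $\rho$ is a permutation of the oriented edges with $\rho(x,y)=(x,\rho_x(y))$, each $\rho_x$ being a cyclic permutation of all neighbours of $x$; this is equivalent to a cellular embedding into an orientable surface. Face boundaries are traced by the orbits of $(x,y)\mapsto\rho(y,x)$; the length of a face is the length of the orbit. A biembedding is an embedding whose faces can be coloured with two colours so that each edge lies on one face of each colour. Two embeddings $(\Gamma,\rho)$ and $(\Gamma',\rho')$ are isomorphic if there is a graph isomorphism $\sigma:\Gamma\to\Gamma'$ (acting on oriented edges by $\sigma(x,y)=(\sigma(x),\sigma(y))$) such that either $\sigma\circ\rho=\rho'\circ\sigma$ or $\sigma\circ\rho=(\rho')^{-1}\circ\sigma$. $\mathrm{Aut}(\Pi)$ is the group of isomorphisms from $\Pi$ to itself; $\mathrm{Aut}(\Pi)=\mathbb{Z}_v$ means that it consists exactly of the translations $\tau_g(x)=x+g$, $g\in\mathbb{Z}_v$. *)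

theory Defs
  imports
    Complex_Main
    "HOL-Number_Theory.Cong"
    "HOL-Number_Theory.Totient"
    "HOL-Combinatorics.Permutations"
    "HOL-Combinatorics.Orbits"
    "Graph_Theory.Digraph_Component"
begin

text \<open>
  Finite simple graphs are symmetric loop-free digraphs without parallel arcs (\<open>pair_graph\<close>), so
  that \<open>parcs\<close> is the set of oriented edges, each edge being present in both orientations.
  An embedding is a pair of a graph and a rotation \<open>\<rho>\<close> of its oriented edges; \<open>\<rho>\<close> is the identity
  outside the set of oriented edges, so that equality of embeddings is equality of pairs.
\<close>

type_synonym 'a rotated_graph = "'a pair_pre_digraph \<times> ('a \<times> 'a \<Rightarrow> 'a \<times> 'a)"

definition neighbours :: "'a pair_pre_digraph \<Rightarrow> 'a \<Rightarrow> 'a set" where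
  "neighbours \<Gamma> x = {y. (x, y) \<in> parcs \<Gamma>}"

text \<open>
  \<open>\<rho>\<^sub>x\<close> is \<open>\<lambda>y. snd (\<rho> (x, y))\<close>. The case \<open>neighbours \<Gamma> x = {}\<close> concerns only the one-vertex
  graph, where there is nothing to rotate, while \<open>cyclic_on\<close> fails on the empty set.
\<close>

definition embedding :: "'a rotated_graph \<Rightarrow> bool" where
  "embedding P \<longleftrightarrow> (case P of (\<Gamma>, \<rho>) \<Rightarrow>
     pair_graph \<Gamma> \<and> Digraph_Component.connected (with_proj \<Gamma>) \<and>
     \<rho> permutes parcs \<Gamma> \<and>
     (\<forall>(x, y) \<in> parcs \<Gamma>. fst (\<rho> (x, y)) = x) \<and>
     (\<forall>x \<in> pverts \<Gamma>. neighbours \<Gamma> x \<noteq> {} \<longrightarrow>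
        cyclic_on (\<lambda>y. snd (\<rho> (x, y))) (neighbours \<Gamma> x)))"

text \<open>A face is identified with the set of oriented edges on the orbit tracing its boundary.\<close>

definition faces :: "'a rotated_graph \<Rightarrow> ('a \<times> 'a) set set" where
  "faces P = (case P of (\<Gamma>, \<rho>) \<Rightarrow> orbit (\<lambda>(x, y). \<rho> (y, x)) ` parcs \<Gamma>)"

abbreviation face_length :: "('a \<times> 'a) set \<Rightarrow> nat" where
  "face_length F \<equiv> card F"

definition biembedding :: "'a rotated_graph \<Rightarrow> bool" where
  "biembedding P \<longleftrightarrow> embedding P \<and>
     (\<exists>colour :: ('a \<times> 'a) set \<Rightarrow> bool.
        \<forall>(x, y) \<in> parcs (fst P). \<forall>c.
          \<exists>!F. F \<in> faces P \<and> colour F = c \<and> ((x, y) \<in> F \<or> (y, x) \<in> F))"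

definition graph_isomorphism ::
    "('a \<Rightarrow> 'b) \<Rightarrow> 'a pair_pre_digraph \<Rightarrow> 'b pair_pre_digraph \<Rightarrow> bool" where
  "graph_isomorphism \<sigma> \<Gamma> \<Gamma>' \<longleftrightarrow>
     bij_betw \<sigma> (pverts \<Gamma>) (pverts \<Gamma>') \<and>
     (\<forall>x \<in> pverts \<Gamma>. \<forall>y \<in> pverts \<Gamma>. (x, y) \<in> parcs \<Gamma> \<longleftrightarrow> (\<sigma> x, \<sigma> y) \<in> parcs \<Gamma>')"

definition embedding_isomorphism ::
    "('a \<Rightarrow> 'b) \<Rightarrow> 'a rotated_graph \<Rightarrow> 'b rotated_graph \<Rightarrow> bool" where
  "embedding_isomorphism \<sigma> P Q \<longleftrightarrow> (case (P, Q) of ((\<Gamma>, \<rho>), (\<Gamma>', \<rho>')) \<Rightarrow>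
     graph_isomorphism \<sigma> \<Gamma> \<Gamma>' \<and>
     ((\<forall>e \<in> parcs \<Gamma>. map_prod \<sigma> \<sigma> (\<rho> e) = \<rho>' (map_prod \<sigma> \<sigma> e)) \<or>
      (\<forall>e \<in> parcs \<Gamma>. map_prod \<sigma> \<sigma> (\<rho> e) = inv \<rho>' (map_prod \<sigma> \<sigma> e))))"

text \<open>Automorphisms are normalised to be the identity outside the vertex set.\<close>

definition Aut :: "'a rotated_graph \<Rightarrow> ('a \<Rightarrow> 'a) set" where
  "Aut P = {\<sigma>. \<sigma> permutes pverts (fst P) \<and> embedding_isomorphism \<sigma> P P}"

definition iso_classes :: "'a rotated_graph set \<Rightarrow> 'a rotated_graph set set" where
  "iso_classes S = S // {(P, Q). P \<in> S \<and> Q \<in> S \<and> (\<exists>\<sigma>. embedding_isomorphism \<sigma> P Q)}"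

definition Zmod :: "nat \<Rightarrow> int set" where
  "Zmod v = {0..<int v}"

definition translation :: "nat \<Rightarrow> int \<Rightarrow> int \<Rightarrow> int" where
  "translation v g x = (if x \<in> Zmod v then (x + g) mod int v else x)"

text \<open>
  For \<open>t\<close> dividing \<open>v\<close>: the subgroup \<open>J\<close> of order \<open>t\<close>, generated by \<open>v/t\<close>, and the complete
  multipartite graph with vertex set \<open>\<int>\<^sub>v\<close> whose \<open>v/t\<close> parts are the cosets of \<open>J\<close>.
\<close>

definition subgroup_J :: "nat \<Rightarrow> nat \<Rightarrow> int set" where
  "subgroup_J v t = (\<lambda>z. (int (v div t) * z) mod int v) ` Zmod v"

definition complete_multipartite :: "nat \<Rightarrow> nat \<Rightarrow> int pair_pre_digraph" where
  "complete_multipartite v t =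
     \<lparr>pverts = Zmod v,
      parcs = {(x, y). x \<in> Zmod v \<and> y \<in> Zmod v \<and> (x - y) mod int v \<notin> subgroup_J v t}\<rparr>"

definition cyclic_biembeddings :: "nat \<Rightarrow> nat \<Rightarrow> nat \<Rightarrow> int rotated_graph set" where
  "cyclic_biembeddings v t k =
     {P. biembedding P \<and> fst P = complete_multipartite v t \<and>
         Aut P = translation v ` Zmod v \<and>
         (\<forall>F \<in> faces P. k dvd face_length F)}"

definition admissible :: "nat \<Rightarrow> nat \<Rightarrow> nat \<Rightarrow> bool" where
  "admissible t n k \<longleftrightarrow>
     n > 0 \<and> k > 0 \<and> k < n \<and> t dvd 2 * n * k \<and>
     ((odd (n * k) \<and> n \<ge> k \<and> k \<ge> 3 \<and> gcd n (k - 1) = 1) \<or>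
      (odd (n * k) \<and> n \<ge> k \<and> 3 < k \<and> k < 200) \<or>
      (odd (n * k) \<and> n \<ge> k \<and> k \<ge> 3 \<and> n \<ge> (k - 2) * (k - 1)))"

end

theory Submission
  imports Defs
begin

text \<open>
  Let \<open>N = nk\<close> and label one difference from each pair \<open>\<plusminus>a\<close> outside \<open>J\<close> by \<open>f i\<close> with \<open>i\<close> modulo \<open>N\<close>. The
  rotation at \<open>x\<close> taking \<open>x + f i\<close> to \<open>x - f (i + 1)\<close> and \<open>x - f i\<close> to \<open>x + f (i + j)\<close> has square
  \<open>i \<mapsto> i + 1 + j\<close>, so it is cyclic if \<open>1 + j\<close> is coprime to \<open>N\<close>, and it gives a translation invariant
  biembedding: the faces of one colour follow \<open>i \<mapsto> i + 1\<close>, those of the other colour \<open>i \<mapsto> i + j\<close>. If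
  \<open>j = n m\<close> with \<open>m\<close> coprime to \<open>k\<close>, all face lengths are multiples of \<open>k\<close>; no condition on the sums
  of the labels is needed.

  Tracing a face for \<open>N\<close> steps is, on the first colour, the translation by the sum \<open>s\<close> of all labels
  (up to sign). Hence an orientation preserving automorphism that fixes \<open>0\<close> and the colours fixes
  \<open>s\<close>, and is the identity if \<open>s\<close> is not in \<open>J\<close>. An orientation reversing one inverts all multiples of
  \<open>s\<close>, which is impossible if \<open>f 0\<close> and \<open>f 1\<close> are such multiples. Exchanging the colours is impossible
  if two of the cycles \<open>i \<mapsto> i + j\<close> have sums that differ enough. These conditions are met by fixing
  four labels and two signs; this leaves at least \<open>2 ^ (N - 2) * (N - 4)!\<close> embeddings, which exceeds
  \<open>N!\<close> if \<open>N\<close> is large. An isomorphism between two such embeddings normalises the translations, so it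
  is affine, and each isomorphism class has at most \<open>2 \<phi>(v)\<close> members. For large \<open>nk\<close> the error term
  is therefore \<open>0\<close>; for the finitely many small \<open>nk\<close> it may be taken to be \<open>1\<close>.
\<close>

subsection \<open>The complete multipartite graph\<close>

text \<open>As \<open>w\<close> divides \<open>v\<close>, reduction modulo \<open>v\<close>
  preserves divisibility by \<open>w\<close>. This lets membership in J be handled as divisibility
  by \<open>w\<close> from here on.\<close>

lemma mem_subgroup_J:
  assumes "t > 0" "v = w * t" "w > 0"
  shows "z \<in> subgroup_J v t \<longleftrightarrow> z \<in> Zmod v \<and> int w dvd z"
proof -
  have vdt: "v div t = w" using assms by simp
  show ?thesis
  proof
    assume "z \<in> subgroup_J v t"
    then obtain y where "z = (int w * y) mod int v"
      unfolding subgroup_J_def vdt by auto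
    moreover have "int w dvd (int w * y) mod int v"
      using assms by (simp add: dvd_mod)
    ultimately show "z \<in> Zmod v \<and> int w dvd z"
      using assms by (simp add: Zmod_def)
  next
    assume z: "z \<in> Zmod v \<and> int w dvd z"
    then obtain y where y: "z = int w * y" by auto
    have "0 \<le> y" using z y assms by (auto simp: Zmod_def zero_le_mult_iff)
    moreover have "y < int v"
    proof -
      have "1 * y \<le> int w * y" using \<open>0 \<le> y\<close> assms by (intro mult_right_mono) auto
      then show ?thesis using z y by (auto simp: Zmod_def)
    qed
    ultimately have "y \<in> Zmod v" by (simp add: Zmod_def)
    moreover have "z = (int w * y) mod int v" using z y by (simp add: Zmod_def)
    ultimately show "z \<in> subgroup_J v t" unfolding subgroup_J_def vdt by auto
  qed
qed

lemma pverts_complete_multipartite [simp]: "pverts (complete_multipartite v t) = Zmod v"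
  by (simp add: complete_multipartite_def)

lemma parcs_complete_multipartite:
  assumes "t > 0" "v = w * t" "w > 0"
  shows "(x, y) \<in> parcs (complete_multipartite v t) \<longleftrightarrow>
    x \<in> Zmod v \<and> y \<in> Zmod v \<and> \<not> int w dvd x - y"
proof -
  have "int v > 0" using assms by simp
  have "int w dvd int v" using assms by simp
  then have "int w dvd (x - y) mod int v \<longleftrightarrow> int w dvd x - y" by (simp add: dvd_mod_iff)
  moreover have "(x - y) mod int v \<in> Zmod v" using \<open>int v > 0\<close> by (simp add: Zmod_def)
  ultimately show ?thesis
    using mem_subgroup_J[OF assms] by (simp add: complete_multipartite_def)
qed

lemma finite_Zmod [simp]: "finite (Zmod v)"
  by (simp add: Zmod_def)

lemma finite_parcs_complete_multipartite [simp]: "finite (parcs (complete_multipartite v t))"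
  by (rule finite_subset[of _ "Zmod v \<times> Zmod v"]) (auto simp: complete_multipartite_def)

lemma pair_graph_complete_multipartite:
  assumes "t > 0" "v = w * t" "w > 0"
  shows "pair_graph (complete_multipartite v t)"
proof
  show "finite (pverts (complete_multipartite v t))" by simp
  show "finite (parcs (complete_multipartite v t))" by simp
  show "Digraph.symmetric (with_proj (complete_multipartite v t))"
    unfolding symmetric_def
    by (auto simp: sym_def arcs_ends_conv parcs_complete_multipartite[OF assms] dvd_diff_commute)
qed (auto simp: parcs_complete_multipartite[OF assms])

lemma connected_complete_multipartite:
  assumes "t > 0" "v = w * t" "w > 1"
  shows "Digraph_Component.connected (with_proj (complete_multipartite v t))"
proof -
  have w0: "w > 0" using assms by simp
  let ?G = "with_proj (complete_multipartite v t)"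
  interpret pair_graph "complete_multipartite v t"
    by (rule pair_graph_complete_multipartite[OF assms(1,2) w0])
  have wf: "wf_digraph ?G" by unfold_locales
  have v: "v > 1" using assms by (metis less_1_mult mult.right_neutral nat_neq_iff less_one)
  have adj: "x \<rightarrow>\<^bsub>?G\<^esub> y" if "x \<in> Zmod v" "y \<in> Zmod v" "\<not> int w dvd x - y" for x y
    using that parcs_complete_multipartite[OF assms(1,2) w0] by (auto simp: arcs_ends_conv)
  have reach: "x \<rightarrow>\<^sup>*\<^bsub>?G\<^esub> y" if xy: "x \<in> Zmod v" "y \<in> Zmod v" for x y
  proof (cases "int w dvd x - y")
    case True
    \<comment> \<open>Here \<open>x\<close> and \<open>y\<close> lie in one part. As
      \<open>w > 1\<close>, the vertex \<open>x + 1\<close> lies in another part and is a common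
      neighbour.\<close>
    define z where "z = (x + 1) mod int v"
    have z: "z \<in> Zmod v" using v by (simp add: z_def Zmod_def)
    have one: "\<not> int w dvd 1" using assms by simp
    have "int w dvd x + 1 - z" unfolding z_def using assms
      by (metis dvd_minus_mod dvd_trans dvd_triv_left of_nat_mult)
    then have zx: "\<not> int w dvd z - x"
      using one by (metis diff_add_cancel add_diff_cancel_left' diff_diff_eq2 dvd_diff dvd_diff_commute)
    moreover have "\<not> int w dvd z - y"
      using zx True by (metis diff_add_cancel dvd_add_right_iff add_diff_eq diff_add_eq_diff_diff_swap dvd_diff_commute diff_add_eq)
    ultimately have "x \<rightarrow>\<^bsub>?G\<^esub> z" "z \<rightarrow>\<^bsub>?G\<^esub> y" using adj xy z by (auto simp: dvd_diff_commute)
    then show ?thesis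
      by (intro wf_digraph.reachable_trans[OF wf, of x z y] wf_digraph.reachable_adjI[OF wf])
  next
    case False
    then show ?thesis by (intro wf_digraph.reachable_adjI[OF wf] adj xy)
  qed
  have "x \<rightarrow>\<^sup>*\<^bsub>mk_symmetric ?G\<^esub> y" if "x \<in> Zmod v" "y \<in> Zmod v" for x y
    using reach[OF that] by (rule wf_digraph.reachable_mk_symmetricI[OF wf])
  moreover have "Zmod v \<noteq> {}" using v by (simp add: Zmod_def)
  ultimately show ?thesis
    by (simp add: Digraph_Component.connected_def strongly_connected_def)
qed

subsection \<open>Embeddings from cyclic labellings\<close>

lemma funpow_mem_orbit: "n > 0 \<Longrightarrow> (h ^^ n) x \<in> orbit h x"
  by (auto simp: orbit_altdef)

text \<open>The values of \<open>f\<close> are arbitrary integers of which only the residues modulo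
  \<open>v\<close> matter. By \<open>inj\<close> and \<open>opposite\<close> no pair of differences
  \<open>a\<close>, \<open>- a\<close> is labelled twice, by \<open>cover\<close> none outside J is
  missed. The map \<open>i \<mapsto> i + (1 + j)\<close> is a single cycle modulo \<open>N\<close>
  by \<open>coprime_j\<close>.\<close>

locale cyclic_labelling =
  fixes v w t N j :: nat and f :: "int \<Rightarrow> int"
  assumes v_eq: "v = w * t" and w_gt_1: "w > 1" and t_pos: "t > 0" and N_gt_2: "N > 2"
    and periodic: "\<And>i. f (i mod int N) = f i"
    and inj: "\<And>i i'. [f i = f i'] (mod int v) \<Longrightarrow> [i = i'] (mod int N)"
    and opposite: "\<And>i i'. \<not> [f i = - f i'] (mod int v)"
    and not_J: "\<And>i. \<not> int w dvd f i"
    and cover: "\<And>z. \<not> int w dvd z \<Longrightarrow> \<exists>i. [z = f i] (mod int v) \<or> [z = - f i] (mod int v)"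
    and coprime_j: "coprime (1 + j) N"
begin

definition A :: "int \<Rightarrow> int \<Rightarrow> int \<times> int" where
  "A x i = (x mod int v, (x + f i) mod int v)"

definition B :: "int \<Rightarrow> int \<Rightarrow> int \<times> int" where
  "B x i = ((x + f i) mod int v, x mod int v)"

text \<open>
  The arc \<open>A x i\<close> leads from \<open>x\<close> along the difference \<open>f i\<close>, and \<open>B x i\<close> is its reverse. The two
  kinds of arcs are the two colours of the faces, and every arc is of exactly one kind. An arc
  determines \<open>x\<close> only modulo \<open>v\<close> and \<open>i\<close> only modulo \<open>N\<close>, but all choices give the same value in \<open>rot\<close>.
\<close>

definition rot :: "int \<times> int \<Rightarrow> int \<times> int" where
  "rot e =
    (if \<exists>x i. e = A x i then SOME e'. \<exists>x i. e = A x i \<and> e' = B (x - f (i + 1)) (i + 1)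
     else if \<exists>x i. e = B x i then SOME e'. \<exists>x i. e = B x i \<and> e' = A (x + f i) (i + int j)
     else e)"

abbreviation \<Gamma> where "\<Gamma> \<equiv> complete_multipartite v t"

text \<open>The face-tracing map of \<open>faces\<close>; its powers yield both the face lengths and
  the control over automorphisms.\<close>

definition T :: "int \<times> int \<Rightarrow> int \<times> int" where "T = (\<lambda>(x, y). rot (y, x))"

lemma v_pos: "v > 0" using v_eq w_gt_1 t_pos by simp

lemma w_dvd_v: "int w dvd int v" using v_eq by simp

lemma f_cong: "[i = i'] (mod int N) \<Longrightarrow> f i = f i'"
  using periodic[of i] periodic[of i'] by (simp add: cong_def)

lemma swap_A: "prod.swap (A x i) = B x i" and swap_B: "prod.swap (B x i) = A x i"
  by (simp_all add: A_def B_def)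

lemma A_cong: "[x = x'] (mod int v) \<Longrightarrow> [i = i'] (mod int N) \<Longrightarrow> A x i = A x' i'"
  unfolding A_def using f_cong[of i i'] cong_add[of x x' "int v" "f i" "f i'"] by (auto simp: cong_def)

lemma B_cong: "[x = x'] (mod int v) \<Longrightarrow> [i = i'] (mod int N) \<Longrightarrow> B x i = B x' i'"
  using A_cong swap_A by metis

lemma A_eq: "A x i = A x' i' \<longleftrightarrow> [x = x'] (mod int v) \<and> [i = i'] (mod int N)"
proof
  assume "A x i = A x' i'"
  then have 1: "[x = x'] (mod int v)" and 2: "[x + f i = x' + f i'] (mod int v)"
    by (auto simp: A_def cong_def)
  then have "[f i = f i'] (mod int v)"
    by (meson cong_add_lcancel cong_add_rcancel cong_sym cong_trans)
  with 1 inj show "[x = x'] (mod int v) \<and> [i = i'] (mod int N)" by blast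
qed (use A_cong in blast)

lemma B_eq: "B x i = B x' i' \<longleftrightarrow> [x = x'] (mod int v) \<and> [i = i'] (mod int N)"
  using A_eq swap_A swap_B by metis

text \<open>An arc of both kinds would give \<open>f i + f i' = 0\<close> modulo \<open>v\<close>,
  against \<open>opposite\<close>.\<close>

lemma A_neq_B: "A x i \<noteq> B x' i'"
proof
  assume "A x i = B x' i'"
  then have "[x = x' + f i'] (mod int v)" "[x + f i = x'] (mod int v)"
    by (auto simp: A_def B_def cong_def)
  then have "[x + f i = x' + f i' + f i] (mod int v)" "[x + f i = x'] (mod int v)"
    using cong_add_rcancel by blast+
  then have "[x' + f i' + f i = x'] (mod int v)" using cong_sym cong_trans by blast
  then have "int v dvd f i + f i'" by (simp add: cong_iff_dvd_diff add.commute)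
  then show False using opposite[of i i'] by (simp add: cong_iff_dvd_diff)
qed

lemma rot_A: "rot (A x i) = B (x - f (i + 1)) (i + 1)"
proof -
  have "rot (A x i) = (SOME e'. \<exists>y l. A x i = A y l \<and> e' = B (y - f (l + 1)) (l + 1))"
    unfolding rot_def by auto
  also have "\<dots> = B (x - f (i + 1)) (i + 1)"
  proof (rule some_equality)
    fix e' assume "\<exists>y l. A x i = A y l \<and> e' = B (y - f (l + 1)) (l + 1)"
    then obtain y l where h: "[x = y] (mod int v)" "[i = l] (mod int N)"
        "e' = B (y - f (l + 1)) (l + 1)"
      using A_eq by auto
    have 1: "[i + 1 = l + 1] (mod int N)" using h cong_add_rcancel by blast
    then have "[x - f (i + 1) = y - f (l + 1)] (mod int v)"
      using h f_cong[OF 1] by (simp add: cong_diff)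
    with h 1 show "e' = B (x - f (i + 1)) (i + 1)" using B_cong cong_sym by blast
  qed blast
  finally show ?thesis .
qed

lemma rot_B: "rot (B x i) = A (x + f i) (i + int j)"
proof -
  have "\<not> (\<exists>y l. B x i = A y l)" using A_neq_B by metis
  then have "rot (B x i) = (SOME e'. \<exists>y l. B x i = B y l \<and> e' = A (y + f l) (l + int j))"
    unfolding rot_def by auto
  also have "\<dots> = A (x + f i) (i + int j)"
  proof (rule some_equality)
    fix e' assume "\<exists>y l. B x i = B y l \<and> e' = A (y + f l) (l + int j)"
    then obtain y l where h: "[x = y] (mod int v)" "[i = l] (mod int N)"
        "e' = A (y + f l) (l + int j)"
      using B_eq by auto
    have 1: "[i + int j = l + int j] (mod int N)" using h cong_add_rcancel by blast
    have "[x + f i = y + f l] (mod int v)"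
      using h f_cong[OF h(2)] by (simp add: cong_add)
    with h 1 show "e' = A (x + f i) (i + int j)" using A_cong cong_sym by blast
  qed blast
  finally show ?thesis .
qed

lemma dvd_mod_diff_iff: "int w dvd x mod int v - y mod int v \<longleftrightarrow> int w dvd x - y"
  using w_dvd_v by (metis mod_eq_dvd_iff mod_mod_cancel)

lemma arcs_iff: "e \<in> parcs \<Gamma> \<longleftrightarrow> (\<exists>x i. e = A x i) \<or> (\<exists>x i. e = B x i)"
proof -
  have w0: "w > 0" using w_gt_1 by simp
  note P = parcs_complete_multipartite[OF t_pos v_eq w0]
  have mem: "x mod int v \<in> Zmod v" for x using v_pos by (simp add: Zmod_def)
  show ?thesis
  proof
    assume e: "e \<in> parcs \<Gamma>"
    obtain x y where xy: "e = (x, y)" by force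
    from e xy P have h: "x \<in> Zmod v" "y \<in> Zmod v" "\<not> int w dvd x - y" by auto
    then have m: "x mod int v = x" "y mod int v = y" by (auto simp: Zmod_def)
    from h cover[of "y - x"] obtain i where "[y - x = f i] (mod int v) \<or> [y - x = - f i] (mod int v)"
      by (auto simp: dvd_diff_commute)
    then show "(\<exists>x i. e = A x i) \<or> (\<exists>x i. e = B x i)"
    proof
      assume "[y - x = f i] (mod int v)"
      then have "[x + (y - x) = x + f i] (mod int v)" by (simp only: cong_add_lcancel)
      then have "e = A x i" using m by (simp add: A_def xy cong_def)
      then show ?thesis by blast
    next
      assume "[y - x = - f i] (mod int v)"
      then have "[x + f i + (y - x) = x + f i + - f i] (mod int v)" by (simp only: cong_add_lcancel)
      then have "e = B y i" using m by (simp add: B_def xy cong_def add.commute)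
      then show ?thesis by blast
    qed
  next
    assume "(\<exists>x i. e = A x i) \<or> (\<exists>x i. e = B x i)"
    then show "e \<in> parcs \<Gamma>"
      using mem not_J by (auto simp: A_def B_def P dvd_mod_diff_iff)
  qed
qed

lemma A_arc [simp]: "A x i \<in> parcs \<Gamma>" and B_arc [simp]: "B x i \<in> parcs \<Gamma>"
  using arcs_iff by blast+

lemma arc_cases:
  assumes "e \<in> parcs \<Gamma>"
  obtains (A) x i where "e = A x i" | (B) x i where "e = B x i"
  using assms arcs_iff by blast

lemma rot_arc: "e \<in> parcs \<Gamma> \<Longrightarrow> rot e \<in> parcs \<Gamma>"
  by (elim arc_cases) (simp_all add: rot_A rot_B)

lemma swap_arc: "e \<in> parcs \<Gamma> \<Longrightarrow> prod.swap e \<in> parcs \<Gamma>"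
  by (elim arc_cases) (simp_all add: swap_A swap_B)

lemma rot_A_inj:
  assumes "rot (A x i) = rot (A x' i')"
  shows "A x i = A x' i'"
proof -
  from assms have h: "[x - f (i + 1) = x' - f (i' + 1)] (mod int v)" "[i + 1 = i' + 1] (mod int N)"
    by (auto simp: rot_A B_eq)
  then have "[x - f (i + 1) + f (i + 1) = x' - f (i' + 1) + f (i' + 1)] (mod int v)"
    using f_cong[OF h(2)] by (metis cong_add_rcancel)
  moreover have "[i = i'] (mod int N)" using h cong_add_rcancel by blast
  ultimately show ?thesis by (simp add: A_eq)
qed

lemma rot_B_inj:
  assumes "rot (B x i) = rot (B x' i')"
  shows "B x i = B x' i'"
proof -
  from assms have h: "[x + f i = x' + f i'] (mod int v)" "[i + int j = i' + int j] (mod int N)"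
    by (auto simp: rot_B A_eq)
  then have i: "[i = i'] (mod int N)" using cong_add_rcancel by blast
  then have "[x = x'] (mod int v)" using h f_cong[OF i] by (metis cong_add_rcancel)
  with i show ?thesis by (simp add: B_eq)
qed

lemma inj_on_rot: "inj_on rot (parcs \<Gamma>)"
proof (rule inj_onI)
  fix e e' assume e: "e \<in> parcs \<Gamma>" "e' \<in> parcs \<Gamma>" and eq: "rot e = rot e'"
  from e(1) show "e = e'"
  proof (cases rule: arc_cases)
    case (A x i)
    note a = A
    from e(2) show ?thesis
    proof (cases rule: arc_cases)
      case (A x' i')
      with a eq rot_A_inj show ?thesis by blast
    next
      case (B x' i')
      with a eq A_neq_B show ?thesis by (metis rot_A rot_B)
    qed
  next
    case (B x i)
    note b = B
    from e(2) show ?thesis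
    proof (cases rule: arc_cases)
      case (A x' i')
      with b eq A_neq_B show ?thesis by (metis rot_A rot_B)
    next
      case (B x' i')
      with b eq rot_B_inj show ?thesis by blast
    qed
  qed
qed

lemma rot_permutes: "rot permutes parcs \<Gamma>"
proof (rule bij_imp_permutes)
  have "rot ` parcs \<Gamma> = parcs \<Gamma>"
    by (rule endo_inj_surj) (use rot_arc inj_on_rot in auto)
  then show "bij_betw rot (parcs \<Gamma>) (parcs \<Gamma>)"
    using inj_on_rot by (simp add: bij_betw_def)
  show "rot e = e" if "e \<notin> parcs \<Gamma>" for e
    using that arcs_iff unfolding rot_def by auto
qed

lemma fst_rot: "e \<in> parcs \<Gamma> \<Longrightarrow> fst (rot e) = fst e"
  by (elim arc_cases) (simp_all add: rot_A rot_B, simp_all add: A_def B_def)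

text \<open>\<open>1 + j\<close> is a unit modulo \<open>N\<close>. Besides the cyclicity of the
  rotation, this later allows an arc at a given vertex to be rotated to any prescribed
  label.\<close>

lemma ex_multiple: "\<exists>l. [i + int l * (1 + int j) = i'] (mod int N)"
proof -
  have "coprime (1 + int j) (int N)"
    using coprime_j by (metis coprime_int_iff of_nat_1 of_nat_add)
  then obtain y where y: "[(1 + int j) * y = 1] (mod int N)"
    using cong_solve_coprime_int by blast
  define l where "l = nat ((y * (i' - i)) mod int N)"
  have "int l = (y * (i' - i)) mod int N" using N_gt_2 by (simp add: l_def)
  then have "[int l * (1 + int j) = y * (i' - i) * (1 + int j)] (mod int N)"
    by (metis cong_mod_left cong_refl cong_scalar_right)
  also have "[y * (i' - i) * (1 + int j) = 1 * (i' - i)] (mod int N)"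
    using cong_scalar_right[OF y, of "i' - i"] by (simp add: mult.commute mult.left_commute)
  finally have "[i + int l * (1 + int j) = i + 1 * (i' - i)] (mod int N)"
    by (simp only: cong_add_lcancel)
  then have "[i + int l * (1 + int j) = i'] (mod int N)" by simp
  then show ?thesis ..
qed

lemma rot_rot_A: "rot (rot (A x i)) = A x (i + 1 + int j)"
  by (simp add: rot_A rot_B)

lemma rot_funpow_A: "(rot ^^ (2 * l)) (A x i) = A x (i + int l * (1 + int j))"
proof (induction l)
  case (Suc l)
  have "(rot ^^ (2 * Suc l)) (A x i) = rot (rot ((rot ^^ (2 * l)) (A x i)))" by simp
  then show ?case by (simp only: Suc rot_rot_A) (simp add: algebra_simps)
qed simp

text \<open>The even powers of the rotation at \<open>x\<close> run through all arcs
  \<open>A x i\<close>. Each remaining neighbour \<open>x - f i\<close> comes one step after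
  \<open>A x (i - 1)\<close>.\<close>

lemma cyclic_rot:
  assumes "x \<in> Zmod v"
  shows "cyclic_on (\<lambda>y. snd (rot (x, y))) (neighbours \<Gamma> x)"
proof -
  let ?r = "\<lambda>y. snd (rot (x, y))"
  have xm: "x mod int v = x" using assms by (auto simp: Zmod_def)
  have step: "?r (snd e) = snd (rot e)" if "fst e = x" for e
    using that by (cases e) auto
  have fstA: "fst (A x i) = x" for i using xm by (simp add: A_def)
  have pow: "fst ((rot ^^ n) (A x 0)) = x \<and> (?r ^^ n) (snd (A x 0)) = snd ((rot ^^ n) (A x 0))
      \<and> (rot ^^ n) (A x 0) \<in> parcs \<Gamma>" for n
  proof (induction n)
    case (Suc n)
    then show ?case using step fst_rot rot_arc by auto
  qed (simp add: fstA)
  have orb: "snd (A x i) \<in> orbit ?r (snd (A x 0))" for i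
  proof -
    \<comment> \<open>An \<open>orbit\<close> consists of positive powers only, so one summand
      \<open>1 + j\<close> is set aside to make the exponent \<open>2 * Suc l\<close>
      positive.\<close>
    obtain l where "[0 + int l * (1 + int j) = i - 1 - int j] (mod int N)"
      using ex_multiple by blast
    then have "[int l * (1 + int j) + (1 + int j) = i - 1 - int j + (1 + int j)] (mod int N)"
      by (metis add_0 cong_add_rcancel)
    then have "[0 + int (Suc l) * (1 + int j) = i] (mod int N)" by (simp add: algebra_simps)
    then have "A x i = (rot ^^ (2 * Suc l)) (A x 0)"
      unfolding rot_funpow_A using A_cong cong_refl cong_sym by blast
    then have "snd (A x i) = (?r ^^ (2 * Suc l)) (snd (A x 0))" using pow by metis
    then show ?thesis by (metis funpow_mem_orbit nat_0_less_mult_iff zero_less_Suc zero_less_numeral)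
  qed
  have "neighbours \<Gamma> x = orbit ?r (snd (A x 0))"
  proof (intro set_eqI iffI)
    fix y assume "y \<in> neighbours \<Gamma> x"
    then have "(x, y) \<in> parcs \<Gamma>" by (simp add: neighbours_def)
    then show "y \<in> orbit ?r (snd (A x 0))"
    proof (cases rule: arc_cases)
      case (A x' i)
      then have "y = snd (A x i)" by (simp add: A_def) (metis mod_add_left_eq xm)
      then show ?thesis using orb by simp
    next
      case (B x' i)
      then have "x = (x' + f i) mod int v" "y = x' mod int v" by (auto simp: B_def)
      then have "y = (x - f i) mod int v" by (simp add: mod_diff_left_eq)
      then have "y = snd (rot (A x (i - 1)))" by (simp add: rot_A B_def)
      also have "\<dots> = ?r (snd (A x (i - 1)))" using step fstA by metis
      finally show ?thesis using orb orbit.step by metis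
    qed
  next
    fix y assume "y \<in> orbit ?r (snd (A x 0))"
    then obtain n where "y = (?r ^^ n) (snd (A x 0))" unfolding orbit_altdef by blast
    then have "(rot ^^ n) (A x 0) = (x, y)" using pow[of n] by (metis prod.collapse)
    then show "y \<in> neighbours \<Gamma> x" using pow[of n] by (simp add: neighbours_def)
  qed
  moreover have "snd (A x 0) \<in> neighbours \<Gamma> x"
    unfolding neighbours_def mem_Collect_eq using A_arc[of x 0] fstA[of 0] by (metis prod.collapse)
  ultimately show ?thesis unfolding cyclic_on_def by blast
qed

lemma embedding_rot: "embedding (\<Gamma>, rot)"
proof -
  have w0: "w > 0" using w_gt_1 by simp
  have 1: "\<forall>(x, y) \<in> parcs \<Gamma>. fst (rot (x, y)) = x"
  proof (intro ballI, unfold split_paired_all prod.case)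
    fix x y assume "(x, y) \<in> parcs \<Gamma>"
    from fst_rot[OF this] show "fst (rot (x, y)) = x" by (simp only: fst_conv)
  qed
  have 2: "\<forall>x \<in> pverts \<Gamma>. neighbours \<Gamma> x \<noteq> {} \<longrightarrow>
      cyclic_on (\<lambda>y. snd (rot (x, y))) (neighbours \<Gamma> x)"
    unfolding pverts_complete_multipartite by (intro ballI impI cyclic_rot)
  show ?thesis
    unfolding embedding_def prod.case
    by (intro conjI 1 2 rot_permutes pair_graph_complete_multipartite[OF t_pos v_eq w0]
      connected_complete_multipartite[OF t_pos v_eq w_gt_1])
qed

end

section \<open>Faces: return times, colours and lengths\<close>

lemma card_orbit_period:
  assumes "x \<in> orbit h x"
  shows "(h ^^ card (orbit h x)) x = x"
proof -
  have "card (orbit h x) = funpow_dist1 h x x"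
    unfolding orbit_conv_funpow_dist1[OF assms]
    by (subst card_image[OF inj_on_funpow_dist1[OF assms]]) simp
  then show ?thesis using funpow_dist1_prop[OF assms] by simp
qed

context cyclic_labelling
begin

lemma T_swap: "T e = rot (prod.swap e)"
  by (cases e) (simp add: T_def)

lemma T_A: "T (A x i) = A (x + f i) (i + int j)"
  by (simp add: T_swap swap_A rot_B)

lemma T_B: "T (B x i) = B (x - f (i + 1)) (i + 1)"
  by (simp add: T_swap swap_B rot_A)

lemma T_funpow_A:
  "(T ^^ m) (A x i) = A (x + (\<Sum>l<m. f (i + int j * int l))) (i + int j * int m)"
proof (induction m)
  case (Suc m)
  then show ?case by (simp add: T_A algebra_simps)
qed simp

lemma T_funpow_B:
  "(T ^^ m) (B x i) = B (x - (\<Sum>l<m. f (i + 1 + int l))) (i + int m)"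
proof (induction m)
  case (Suc m)
  then show ?case by (simp add: T_B algebra_simps)
qed simp

lemma T_arc: "e \<in> parcs \<Gamma> \<Longrightarrow> T e \<in> parcs \<Gamma>"
  by (simp only: T_swap rot_arc swap_arc)

lemma T_funpow_arc: "e \<in> parcs \<Gamma> \<Longrightarrow> (T ^^ m) e \<in> parcs \<Gamma>"
  by (induction m) (simp_all add: T_arc)

lemma inj_on_T: "inj_on T (parcs \<Gamma>)"
proof (rule inj_onI)
  fix e e' assume "e \<in> parcs \<Gamma>" "e' \<in> parcs \<Gamma>" "T e = T e'"
  then have "prod.swap e = prod.swap e'"
    using inj_on_rot swap_arc unfolding T_swap inj_on_def by blast
  then show "e = e'" by (metis swap_swap)
qed

lemma self_in_orbit_T:
  assumes "e \<in> parcs \<Gamma>"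
  shows "e \<in> orbit T e"
proof -
  \<comment> \<open>Outside the arcs \<open>T\<close> is the swap, which moves infinitely many
    pairs. The restriction has finite support, hence is a \<open>permutation\<close>, and has the
    same orbits on arcs.\<close>
  let ?P = "perm_restrict T (parcs \<Gamma>)"
  have "T ` parcs \<Gamma> = parcs \<Gamma>"
    by (rule endo_inj_surj) (use T_arc inj_on_T in auto)
  then have "bij_betw T (parcs \<Gamma>) (parcs \<Gamma>)" using inj_on_T by (simp add: bij_betw_def)
  then have "bij_betw ?P (parcs \<Gamma>) (parcs \<Gamma>)"
    by (rule bij_betw_cong[THEN iffD1, rotated]) (simp add: perm_restrict_def)
  then have "?P permutes parcs \<Gamma>"
    by (rule bij_imp_permutes) (simp add: perm_restrict_def)
  then have "permutation ?P"
    unfolding permutation_permutes using finite_parcs_complete_multipartite by blast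
  then have "e \<in> orbit ?P e" by (rule permutation_self_in_orbit)
  moreover have "orbit T e = orbit ?P e"
    by (rule orbit_cong0[OF assms]) (auto simp: T_arc perm_restrict_def)
  ultimately show ?thesis by simp
qed

lemma orbit_T_eq:
  assumes "e \<in> parcs \<Gamma>" "e' \<in> orbit T e"
  shows "orbit T e' = orbit T e"
  using self_in_orbit_T[OF assms(1)] assms(2) orbit_swap orbit_trans by (metis subsetI subset_antisym)

lemma orbit_T_A: "e \<in> orbit T (A x i) \<Longrightarrow> \<exists>y l. e = A y l"
  by (induction rule: orbit.induct) (metis T_A)+

lemma orbit_T_B: "e \<in> orbit T (B x i) \<Longrightarrow> \<exists>y l. e = B y l"
  by (induction rule: orbit.induct) (metis T_B)+

lemma faces_eq: "faces (\<Gamma>, rot) = orbit T ` parcs \<Gamma>"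
  by (simp add: faces_def T_def)

text \<open>\<open>T\<close> preserves the kind of an arc, so each face has arcs of one kind only,
  while an edge carries one arc of each kind, \<open>A z l\<close> and its reverse
  \<open>B z l\<close>.\<close>

lemma biembedding_rot: "biembedding (\<Gamma>, rot)"
proof -
  define colour where "colour F \<longleftrightarrow> (\<exists>x i. A x i \<in> F)" for F
  have colourA: "colour (orbit T (A x i))" for x i
    unfolding colour_def using self_in_orbit_T[OF A_arc] by blast
  have colourB: "\<not> colour (orbit T (B x i))" for x i
    unfolding colour_def using orbit_T_B A_neq_B by metis
  have unique: "\<exists>!F. F \<in> faces (\<Gamma>, rot) \<and> colour F = c \<and> (A z l \<in> F \<or> B z l \<in> F)" for c z l
  proof (rule ex1I[of _ "orbit T (if c then A z l else B z l)"])
    show "orbit T (if c then A z l else B z l) \<in> faces (\<Gamma>, rot) \<and>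
        colour (orbit T (if c then A z l else B z l)) = c \<and>
        (A z l \<in> orbit T (if c then A z l else B z l) \<or> B z l \<in> orbit T (if c then A z l else B z l))"
      using colourA colourB self_in_orbit_T[OF A_arc, of z l] self_in_orbit_T[OF B_arc, of z l]
      by (cases c) (simp_all add: faces_eq)
  next
    fix F assume F: "F \<in> faces (\<Gamma>, rot) \<and> colour F = c \<and> (A z l \<in> F \<or> B z l \<in> F)"
    then obtain e where e: "e \<in> parcs \<Gamma>" "F = orbit T e" unfolding faces_eq by blast
    from e(1) show "F = orbit T (if c then A z l else B z l)"
    proof (cases rule: arc_cases)
      case (A x i)
      then have "c" using F e colourA by simp
      moreover have "B z l \<notin> F" using orbit_T_A A_neq_B e A by metis
      ultimately show ?thesis using F e orbit_T_eq by auto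
    next
      case (B x i)
      then have "\<not> c" using F e colourB by simp
      moreover have "A z l \<notin> F" using orbit_T_B A_neq_B e B by metis
      ultimately show ?thesis using F e orbit_T_eq by auto
    qed
  qed
  have "\<forall>(x, y) \<in> parcs \<Gamma>. \<forall>c. \<exists>!F. F \<in> faces (\<Gamma>, rot) \<and> colour F = c \<and> ((x, y) \<in> F \<or> (y, x) \<in> F)"
  proof (intro ballI, unfold split_paired_all prod.case, intro allI)
    fix x y c assume "(x, y) \<in> parcs \<Gamma>"
    then show "\<exists>!F. F \<in> faces (\<Gamma>, rot) \<and> colour F = c \<and> ((x, y) \<in> F \<or> (y, x) \<in> F)"
    proof (cases rule: arc_cases)
      case (A z l)
      then have "(y, x) = B z l" using swap_A[of z l] by (metis swap_simp)
      then show ?thesis using unique[of c z l] A by simp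
    next
      case (B z l)
      then have "(y, x) = A z l" using swap_B[of z l] by (metis swap_simp)
      then show ?thesis using unique[of c z l] B by (simp add: disj_commute)
    qed
  qed
  then show ?thesis
    unfolding biembedding_def fst_conv using embedding_rot by blast
qed

text \<open>When a face closes after \<open>m\<close> steps, its label index has returned as well:
  \<open>N\<close> divides \<open>j * m\<close> for arcs of kind \<open>A\<close> and
  \<open>m\<close> for arcs of kind \<open>B\<close>.\<close>

lemma dvd_face_length:
  assumes "\<And>m. N dvd j * m \<Longrightarrow> k dvd m" "k dvd N" "F \<in> faces (\<Gamma>, rot)"
  shows "k dvd face_length F"
proof -
  from assms(3) obtain e where e: "e \<in> parcs \<Gamma>" "F = orbit T e" unfolding faces_eq by blast
  have period: "(T ^^ card F) e = e" unfolding e(2) by (rule card_orbit_period[OF self_in_orbit_T[OF e(1)]])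
  from e(1) show ?thesis
  proof (cases rule: arc_cases)
    case (A x i)
    then have "[i + int j * int (card F) = i] (mod int N)" using period by (simp add: T_funpow_A A_eq)
    then have "int N dvd int (j * card F)" by (simp add: cong_iff_dvd_diff)
    then show ?thesis using assms(1) int_dvd_int_iff by blast
  next
    case (B x i)
    then have "[i + int (card F) = i] (mod int N)" using period by (simp add: T_funpow_B B_eq)
    then have "N dvd card F" by (simp add: cong_iff_dvd_diff)
    then show ?thesis using assms(2) dvd_trans by blast
  qed
qed

section \<open>Translations obtained by tracing a face for \<open>N\<close> steps\<close>

definition s :: int where "s = (\<Sum>l<N. f (int l))"

definition S :: "int \<Rightarrow> int" where "S i = (\<Sum>l<N. f (i + int j * int l))"

text \<open>
  Tracing a face for \<open>N\<close> steps translates an arc of kind \<open>B\<close> by \<open>- s\<close>, whatever its label, but an arc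
  \<open>A x i\<close> by \<open>S i\<close>, which depends on the face through the cycle of \<open>i\<close> under \<open>i \<mapsto> i + j\<close>.
\<close>

lemma sum_period: "(\<Sum>l<N. f (i + int l)) = s"
proof -
  have shift: "(\<Sum>l<N. f (i + 1 + int l)) = (\<Sum>l<N. f (i + int l))" for i
  proof -
    have "f (i + int N) = f i" by (rule f_cong) (simp add: cong_def)
    then have "f i + (\<Sum>l<N. f (i + int (Suc l))) = f i + (\<Sum>l<N. f (i + int l))"
      using sum.lessThan_Suc_shift[of "\<lambda>l. f (i + int l)" N] by (simp add: add.commute)
    then show ?thesis by (simp add: add.assoc)
  qed
  show ?thesis
  proof (induction i rule: int_induct[of _ 0])
    case base
    then show ?case by (simp add: s_def)
  next
    case (step1 i)
    then show ?case using shift[of i] by simp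
  next
    case (step2 i)
    then show ?case using shift[of "i - 1"] by simp
  qed
qed

lemma S_cong: "[i = i'] (mod int N) \<Longrightarrow> S i = S i'"
  unfolding S_def by (intro sum.cong refl f_cong cong_add) auto

lemma T_funpow_N_B: "(T ^^ N) (B x i) = B (x - s) i"
  unfolding T_funpow_B sum_period by (rule B_cong) (simp_all add: cong_def)

lemma T_funpow_N_A: "(T ^^ N) (A x i) = A (x + S i) i"
  unfolding T_funpow_A S_def by (rule A_cong) (simp_all add: cong_def)

lemma rot_funpow_B: "\<exists>y. (rot ^^ (2 * m)) (B x i) = B y (i + int m * (1 + int j))"
proof (induction m)
  case (Suc m)
  then obtain y where y: "(rot ^^ (2 * m)) (B x i) = B y (i + int m * (1 + int j))" by blast
  have "(rot ^^ (2 * Suc m)) (B x i) = rot (rot ((rot ^^ (2 * m)) (B x i)))" by simp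
  then show ?case by (simp only: y rot_A rot_B) (auto simp: algebra_simps)
qed auto

lemma fst_rot_funpow: "e \<in> parcs \<Gamma> \<Longrightarrow> (rot ^^ m) e \<in> parcs \<Gamma> \<and> fst ((rot ^^ m) e) = fst e"
  by (induction m) (simp_all add: rot_arc fst_rot)

subsection \<open>Automorphisms\<close>

abbreviation \<tau> :: "int \<Rightarrow> int \<times> int \<Rightarrow> int \<times> int" where
  "\<tau> g \<equiv> map_prod (\<lambda>x. (x + g) mod int v) (\<lambda>x. (x + g) mod int v)"

lemma translate_A: "\<tau> g (A x i) = A (x + g) i"
  by (simp add: A_def mod_simps algebra_simps)

lemma translate_B: "\<tau> g (B x i) = B (x + g) i"
  by (simp add: B_def mod_simps algebra_simps)

lemma translate_rot: "e \<in> parcs \<Gamma> \<Longrightarrow> \<tau> g (rot e) = rot (\<tau> g e)"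
  by (elim arc_cases) (simp_all add: rot_A rot_B translate_A translate_B algebra_simps)

lemma arc_ends: "(x, y) \<in> parcs \<Gamma> \<longleftrightarrow> x \<in> Zmod v \<and> y \<in> Zmod v \<and> \<not> int w dvd x - y"
  using parcs_complete_multipartite[OF t_pos v_eq] w_gt_1 by simp

text \<open>Commuting with \<open>rot\<close> spreads agreement with a translation from one arc at a
  vertex to all arcs at that vertex. As \<open>x0\<close> and \<open>y0\<close> lie in different
  parts, every vertex is a neighbour of one of them.\<close>

lemma rigid:
  assumes comm: "\<And>e. e \<in> parcs \<Gamma> \<Longrightarrow> map_prod \<sigma> \<sigma> (rot e) = rot (map_prod \<sigma> \<sigma> e)"
    and arc: "(x0, y0) \<in> parcs \<Gamma>"
    and x0: "\<sigma> x0 = (x0 + g) mod int v" and y0: "\<sigma> y0 = (y0 + g) mod int v"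
    and z: "z \<in> Zmod v"
  shows "\<sigma> z = (z + g) mod int v"
proof -
  define P where "P e \<longleftrightarrow> map_prod \<sigma> \<sigma> e = \<tau> g e" for e
  have P_pair: "P (x, y) \<longleftrightarrow> \<sigma> x = (x + g) mod int v \<and> \<sigma> y = (y + g) mod int v" for x y
    by (simp add: P_def)
  have P_rot: "P (rot e)" if "P e" "e \<in> parcs \<Gamma>" for e
    using that comm translate_rot by (simp add: P_def)
  have P_vertex: "P (x, y')" if xy: "P (x, y)" "(x, y) \<in> parcs \<Gamma>" "(x, y') \<in> parcs \<Gamma>" for x y y'
  proof -
    let ?r = "\<lambda>y. snd (rot (x, y))"
    have "x \<in> Zmod v" using xy arc_ends by blast
    then have "neighbours \<Gamma> x = orbit ?r y"
      using cyclic_rot orbit_cyclic_eq3 xy(2) unfolding neighbours_def by (metis mem_Collect_eq)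
    then have "y' \<in> orbit ?r y" using xy(3) unfolding neighbours_def by blast
    moreover have step: "(x, ?r y) = rot (x, y)" if "(x, y) \<in> parcs \<Gamma>" for y
      using fst_rot[OF that] by (metis fst_conv prod.collapse)
    ultimately have "P (x, y') \<and> (x, y') \<in> parcs \<Gamma>"
    proof (induction rule: orbit.induct)
      case base
      show ?case using step[OF xy(2)] P_rot[OF xy(1,2)] rot_arc[OF xy(2)] by simp
    next
      case (step u)
      then show ?case using P_rot[of "(x, u)"] rot_arc[of "(x, u)"] by metis
    qed
    then show ?thesis by blast
  qed
  show ?thesis
  proof (cases "(x0, z) \<in> parcs \<Gamma>")
    case True
    then show ?thesis using P_vertex[of x0 y0 z] arc x0 y0 P_pair by blast
  next
    case False
    then have "int w dvd x0 - z" using z arc arc_ends by blast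
    moreover have n: "\<not> int w dvd x0 - y0" using arc arc_ends by blast
    ultimately have "\<not> int w dvd y0 - z"
      by (metis diff_diff_eq2 diff_add_cancel dvd_diff add_diff_cancel_left' diff_add_eq)
    then have "(y0, z) \<in> parcs \<Gamma>" "(y0, x0) \<in> parcs \<Gamma>"
      using arc z arc_ends by (auto simp: dvd_diff_commute)
    then show ?thesis using P_vertex[of y0 x0 z] x0 y0 P_pair by blast
  qed
qed

end

lemma translation_permutes:
  assumes "v > 0"
  shows "translation v g permutes Zmod v"
proof (rule bij_imp_permutes)
  have "inj_on (translation v g) (Zmod v)"
  proof (rule inj_onI)
    fix x y assume xy: "x \<in> Zmod v" "y \<in> Zmod v" "translation v g x = translation v g y"
    then have "[x + g = y + g] (mod int v)" by (simp add: translation_def cong_def)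
    then have "[x = y] (mod int v)" by (simp only: cong_add_rcancel)
    then show "x = y" using xy by (simp add: cong_def Zmod_def)
  qed
  moreover have "translation v g ` Zmod v \<subseteq> Zmod v"
    using assms by (auto simp: translation_def Zmod_def)
  ultimately show "bij_betw (translation v g) (Zmod v) (Zmod v)"
    using endo_inj_surj[OF finite_Zmod] by (auto simp: bij_betw_def)
qed (simp add: translation_def)

context cyclic_labelling
begin

lemma fst_A: "fst (A x i) = x mod int v" and snd_A: "snd (A x i) = (x + f i) mod int v"
  and fst_B: "fst (B x i) = (x + f i) mod int v" and snd_B: "snd (B x i) = x mod int v"
  by (simp_all add: A_def B_def)

text \<open>
  An automorphism preserves or exchanges the colours. In the first case it commutes with the
  translation by \<open>s\<close>, so it agrees with a translation on an arc; in the second case conjugation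
  by it would turn the translation by \<open>s\<close> into all the translations by \<open>S i\<close> at once.
\<close>

lemma aut_preserving:
  assumes arc: "\<And>e. e \<in> parcs \<Gamma> \<Longrightarrow> map_prod \<sigma> \<sigma> e \<in> parcs \<Gamma>"
    and comm: "\<And>e. e \<in> parcs \<Gamma> \<Longrightarrow> map_prod \<sigma> \<sigma> (rot e) = rot (map_prod \<sigma> \<sigma> e)"
    and s: "\<not> int w dvd s"
    and uneven: "\<not> [S a = S b] (mod int v)"
    and z: "z \<in> Zmod v"
  shows "\<sigma> z = (z + \<sigma> 0) mod int v"
proof -
  let ?M = "map_prod \<sigma> \<sigma>"
  have zero: "0 \<in> Zmod v" using v_pos by (simp add: Zmod_def)
  have M_swap: "?M (prod.swap e) = prod.swap (?M e)" for e by (cases e) simp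
  have M_T: "?M ((T ^^ m) e) = (T ^^ m) (?M e)" if "e \<in> parcs \<Gamma>" for m e
  proof (induction m)
    case (Suc m)
    have "?M (rot (prod.swap ((T ^^ m) e))) = rot (?M (prod.swap ((T ^^ m) e)))"
      by (intro comm swap_arc T_funpow_arc that)
    then have "?M (T ((T ^^ m) e)) = T (?M ((T ^^ m) e))" by (simp only: T_swap M_swap)
    then show ?case by (simp add: Suc)
  qed simp
  have M_rot: "?M ((rot ^^ m) e) = (rot ^^ m) (?M e)" if "e \<in> parcs \<Gamma>" for m e
    by (induction m) (simp_all add: comm fst_rot_funpow that)
  from arc[OF B_arc] show ?thesis
  proof (cases rule: arc_cases[of "?M (B 0 0)"])
    case (B y l)
    have "\<sigma> (snd (B 0 0)) = snd (B y l)" using B by (metis snd_map_prod)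
    then have y: "\<sigma> 0 = y mod int v" by (simp add: snd_B)
    have "?M (B (0 - s) 0) = B (y - s) l"
      using M_T[OF B_arc, of N 0 0] unfolding T_funpow_N_B B .
    then have "\<sigma> (snd (B (0 - s) 0)) = snd (B (y - s) l)" by (metis snd_map_prod)
    then have "\<sigma> ((- s) mod int v) = (y - s) mod int v" by (simp add: snd_B)
    then have "\<sigma> ((- s) mod int v) = ((- s) mod int v + \<sigma> 0) mod int v"
      using y by (simp add: mod_simps algebra_simps)
    moreover have "\<sigma> 0 = (0 + \<sigma> 0) mod int v" using y by simp
    moreover have "(0, (- s) mod int v) \<in> parcs \<Gamma>"
      using s zero v_pos dvd_mod_diff_iff[of 0 "- s"] by (simp add: arc_ends Zmod_def)
    ultimately show ?thesis using rigid[OF comm] z by blast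
  next
    case (A y l)
    have MA: "?M (A 0 0) = B y l" using A M_swap[of "B 0 0"] by (simp add: swap_A swap_B)
    \<comment> \<open>Rotating about the vertex 0 gives the image arc any label \<open>l'\<close>.
      Then \<open>T ^^ N\<close> moves the original arc by \<open>- s\<close> and its image by
      \<open>S l'\<close>, so the left side, which is free of \<open>l'\<close>, forces
      \<open>S\<close> to be constant.\<close>
    have "\<sigma> ((- s) mod int v) = (\<sigma> 0 + S l') mod int v" for l'
    proof -
      obtain m where m: "[l + int m * (1 + int j) = l'] (mod int N)" using ex_multiple by blast
      define i where "i = 0 + int m * (1 + int j)"
      have "?M (A 0 i) = (rot ^^ (2 * m)) (B y l)"
        using M_rot[OF A_arc, of "2 * m" 0 0] unfolding MA rot_funpow_A i_def .
      then obtain y' where "?M (A 0 i) = B y' (l + int m * (1 + int j))"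
        using rot_funpow_B by metis
      then have "?M (A 0 i) = B y' l'" using B_cong[OF cong_refl m] by simp
      then have MB: "?M (B 0 i) = A y' l'" using M_swap[of "A 0 i"] by (simp add: swap_A swap_B)
      then have "\<sigma> (snd (B 0 i)) = snd (A y' l')" by (metis snd_map_prod)
      then have y': "\<sigma> 0 = (y' + f l') mod int v" by (simp add: snd_A snd_B)
      have "?M (B (0 - s) i) = A (y' + S l') l'"
        using M_T[OF B_arc, of N 0 i] unfolding T_funpow_N_B MB T_funpow_N_A .
      then have "\<sigma> (snd (B (0 - s) i)) = snd (A (y' + S l') l')" by (metis snd_map_prod)
      then have "\<sigma> ((- s) mod int v) = (y' + S l' + f l') mod int v" by (simp add: snd_A snd_B)
      then show ?thesis using y' by (simp add: mod_simps algebra_simps)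
    qed
    then have "(\<sigma> 0 + S a) mod int v = (\<sigma> 0 + S b) mod int v" by metis
    then have "[\<sigma> 0 + S a = \<sigma> 0 + S b] (mod int v)" by (simp only: cong_def)
    then have "[S a = S b] (mod int v)" by (simp only: cong_add_lcancel)
    then show ?thesis using uneven by blast
  qed
qed

text \<open>For reversing \<open>\<sigma>\<close>, the map \<open>?K\<close> satisfies
  \<open>T \<circ> ?K \<circ> T = ?K\<close> on arcs, so it inverts \<open>T\<close>. If
  \<open>?K\<close> keeps the kind of an arc, \<open>\<sigma>\<close> sends \<open>c * s\<close> to
  \<open>\<sigma> 0 - c * s\<close>, and the rotation at 0 yields \<open>f 2 = f 0\<close> modulo
  \<open>v\<close>. If it exchanges the kinds, \<open>S\<close> would again be constant.\<close>

lemma aut_reversing: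
  assumes arc: "\<And>e. e \<in> parcs \<Gamma> \<Longrightarrow> map_prod \<sigma> \<sigma> e \<in> parcs \<Gamma>"
    and anti: "\<And>e. e \<in> parcs \<Gamma> \<Longrightarrow> rot (map_prod \<sigma> \<sigma> (rot e)) = map_prod \<sigma> \<sigma> e"
    and f0: "[f 0 = a0 * s] (mod int v)" and f1: "[f 1 = a1 * s] (mod int v)"
    and uneven: "\<not> [S a = S b] (mod int v)"
  shows False
proof -
  let ?M = "map_prod \<sigma> \<sigma>"
  let ?K = "\<lambda>e. prod.swap (?M e)"
  have zero: "0 \<in> Zmod v" using v_pos by (simp add: Zmod_def)
  have M_swap: "?M (prod.swap e) = prod.swap (?M e)" for e by (cases e) simp
  have K_arc: "?K e \<in> parcs \<Gamma>" if "e \<in> parcs \<Gamma>" for e using that arc swap_arc by blast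
  have K_T: "T (?K (T e)) = ?K e" if "e \<in> parcs \<Gamma>" for e
  proof -
    have "T (?K (T e)) = rot (?M (rot (prod.swap e)))" by (simp add: T_swap)
    also have "\<dots> = ?M (prod.swap e)" by (rule anti) (rule swap_arc[OF that])
    finally show ?thesis by (simp only: M_swap)
  qed
  have K_Tm: "(T ^^ m) (?K ((T ^^ m) e)) = ?K e" if "e \<in> parcs \<Gamma>" for m e
  proof (induction m)
    case (Suc m)
    have "(T ^^ Suc m) (?K ((T ^^ Suc m) e)) = (T ^^ m) (T (?K (T ((T ^^ m) e))))"
      by (simp only: funpow.simps o_apply funpow_swap1)
    also have "\<dots> = (T ^^ m) (?K ((T ^^ m) e))" by (simp only: K_T[OF T_funpow_arc[OF that]])
    finally show ?case by (simp only: Suc)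
  qed simp
  have M_rotm: "(rot ^^ m) (?M ((rot ^^ m) e)) = ?M e" if "e \<in> parcs \<Gamma>" for m e
  proof (induction m)
    case (Suc m)
    have "(rot ^^ Suc m) (?M ((rot ^^ Suc m) e)) = (rot ^^ m) (rot (?M (rot ((rot ^^ m) e))))"
      by (simp only: funpow.simps o_apply funpow_swap1)
    also have "\<dots> = (rot ^^ m) (?M ((rot ^^ m) e))"
      using anti fst_rot_funpow[OF that] by metis
    finally show ?case by (simp only: Suc)
  qed simp
  have s0: "\<sigma> 0 \<in> Zmod v" using arc[OF B_arc[of 0 0]] by (auto simp: B_def arc_ends)
  then have s0m: "\<sigma> 0 mod int v = \<sigma> 0" by (simp add: Zmod_def)
  from K_arc[OF B_arc] show False
  proof (cases rule: arc_cases[of "?K (B 0 0)"])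
    case (B y l)
    have KB: "?K (B (- int m * s) 0) = B (y + int m * s) l" for m
    proof (induction m)
      case 0
      then show ?case using B by simp
    next
      case (Suc m)
      have e: "(T ^^ N) (B (- int m * s) 0) = B (- int (Suc m) * s) 0"
      proof -
        have "- int m * s - s = - int (Suc m) * s" by (simp add: algebra_simps)
        then show ?thesis by (simp only: T_funpow_N_B)
      qed
      have "(T ^^ N) (?K (B (- int (Suc m) * s) 0)) = B (y + int m * s) l"
        using K_Tm[OF B_arc, of N "- int m * s" 0] unfolding e Suc .
      \<comment> \<open>\<open>K_Tm\<close> tells only where \<open>T ^^ N\<close> sends this arc.
        As \<open>T\<close> preserves kinds, the arc is of kind \<open>B\<close>, and undoing
        \<open>T ^^ N\<close> adds \<open>s\<close>.\<close>
      moreover from K_arc[OF B_arc] have "?K (B (- int (Suc m) * s) 0) = B (y + int (Suc m) * s) l"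
        if "(T ^^ N) (?K (B (- int (Suc m) * s) 0)) = B (y + int m * s) l"
      proof (cases rule: arc_cases[of "?K (B (- int (Suc m) * s) 0)"])
        case (A y' l')
        then show ?thesis using that A_neq_B by (metis T_funpow_N_A)
      next
        case (B y' l')
        then have "B (y' - s) l' = B (y + int m * s) l" using that by (simp only: T_funpow_N_B)
        then have h: "[y' - s = y + int m * s] (mod int v)" "[l' = l] (mod int N)"
          by (simp_all only: B_eq)
        then have "[y' - s + s = y + int m * s + s] (mod int v)" by (simp only: cong_add_rcancel)
        then have "[y' = y + int (Suc m) * s] (mod int v)" by (simp add: algebra_simps)
        with h B show ?thesis using B_cong by simp
      qed
      ultimately show ?case by blast
    qed
    have K_pair: "fst (?K e) = \<sigma> (snd e)" for e by (cases e) simp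
    have nat_mult: "\<sigma> ((- int m * s) mod int v) = (y + f l + int m * s) mod int v" for m
      using K_pair[of "B (- int m * s) 0"] unfolding KB by (simp add: fst_B snd_B algebra_simps)
    from nat_mult[of 0] have y: "\<sigma> 0 = (y + f l) mod int v" by simp
    have mult: "\<sigma> ((c * s) mod int v) = (\<sigma> 0 - c * s) mod int v" for c
    proof -
      \<comment> \<open>\<open>nat_mult\<close> treats the factors \<open>- int m\<close> only, but
        modulo \<open>v\<close> every integer \<open>c\<close> is of this form.\<close>
      define m where "m = nat ((- c) mod int v)"
      have "int m = (- c) mod int v" using v_pos by (simp add: m_def)
      then have m: "[- int m = c] (mod int v)" by (simp add: cong_def mod_simps)
      then have "[- int m * s = c * s] (mod int v)" by (rule cong_scalar_right)
      then have "(- int m * s) mod int v = (c * s) mod int v" by (simp only: cong_def)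
      moreover have "(y + f l + int m * s) mod int v = (\<sigma> 0 - c * s) mod int v"
      proof -
        have "[y + f l - (- int m * s) = y + f l - c * s] (mod int v)"
          using \<open>[- int m * s = c * s] (mod int v)\<close> by (intro cong_diff cong_refl)
        then have "(y + f l + int m * s) mod int v = (y + f l - c * s) mod int v"
          by (simp add: cong_def)
        then show ?thesis unfolding y by (simp add: mod_simps)
      qed
      ultimately show ?thesis using nat_mult[of m] by metis
    qed
    have neg: "[- f 1 = - a1 * s] (mod int v)" using f1 by (simp add: cong_minus_minus_iff)
    have \<sigma>f0: "\<sigma> (f 0 mod int v) = (\<sigma> 0 - f 0) mod int v"
    proof -
      have "f 0 mod int v = (a0 * s) mod int v" using f0 by (simp only: cong_def)
      then show ?thesis using mult[of a0] by (metis mod_diff_right_eq)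
    qed
    have \<sigma>f1: "\<sigma> ((- f 1) mod int v) = (\<sigma> 0 + f 1) mod int v"
    proof -
      have e: "(- f 1) mod int v = (- a1 * s) mod int v" using neg by (simp only: cong_def)
      then show ?thesis using mult[of "- a1"] by (metis mod_diff_right_eq diff_minus_eq_add)
    qed
    \<comment> \<open>The rotation leads from the difference \<open>f 0\<close> to
      \<open>- f 1\<close>, whose image is the arc with label 1 at \<open>\<sigma> 0\<close>.
      Rotating once more must give the image of \<open>A 0 0\<close>, which thus has label
      2.\<close>
    have "?M (rot (A 0 0)) = (\<sigma> 0, (\<sigma> 0 + f 1) mod int v)"
      by (simp add: rot_A B_def \<sigma>f1)
    also have "\<dots> = A (\<sigma> 0) 1" using s0m by (simp add: A_def)
    finally have "rot (?M (rot (A 0 0))) = B (\<sigma> 0 - f 2) 2" by (simp add: rot_A)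
    then have "?M (A 0 0) = B (\<sigma> 0 - f 2) 2" using anti[OF A_arc] by simp
    then have "\<sigma> (snd (A 0 0)) = (\<sigma> 0 - f 2) mod int v" by (metis snd_map_prod snd_B)
    then have "(\<sigma> 0 - f 0) mod int v = (\<sigma> 0 - f 2) mod int v" by (simp add: snd_A \<sigma>f0)
    then have "[\<sigma> 0 - f 0 = \<sigma> 0 - f 2] (mod int v)" by (simp only: cong_def)
    then have "int v dvd f 2 - f 0" by (simp add: cong_iff_dvd_diff)
    then have "[f 2 = f 0] (mod int v)" by (simp only: cong_iff_dvd_diff)
    then have "[2 = 0] (mod int N)" by (rule inj)
    then have "int N dvd 2" by (simp add: cong_iff_dvd_diff)
    then have "int N \<le> 2" by (rule zdvd_imp_le) simp
    then show False using N_gt_2 by simp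
  next
    case (A y l)
    have MA: "?M (A 0 0) = A y l" using A M_swap[of "B 0 0"] by (simp add: swap_A swap_B)
    then have "\<sigma> (fst (A 0 0)) = fst (A y l)" by (metis fst_map_prod)
    then have y: "\<sigma> 0 = y mod int v" by (simp add: fst_A)
    have "\<sigma> ((- s) mod int v) = (\<sigma> 0 - S l') mod int v" for l'
    proof -
      \<comment> \<open>The image rotates backwards, so \<open>m\<close> has to lead from the wanted
        label \<open>l'\<close> to \<open>l\<close>, not from \<open>l\<close> to
        \<open>l'\<close>.\<close>
      obtain m where m: "[l' + int m * (1 + int j) = l] (mod int N)" using ex_multiple by blast
      define i where "i = 0 + int m * (1 + int j)"
      have X: "(rot ^^ (2 * m)) (?M (A 0 i)) = A y l"
        using M_rotm[OF A_arc, of "2 * m" 0 0] unfolding MA rot_funpow_A i_def .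
      have MAi: "?M (A 0 i) = A y l'"
      proof (cases rule: arc_cases[OF arc[OF A_arc[of 0 i]]])
        case (1 x' i')
        then have "A x' (i' + int m * (1 + int j)) = A y l" using X by (simp only: rot_funpow_A)
        then have h: "[x' = y] (mod int v)" "[i' + int m * (1 + int j) = l] (mod int N)"
          by (simp_all only: A_eq)
        then have "[i' + int m * (1 + int j) = l' + int m * (1 + int j)] (mod int N)"
          using m cong_sym cong_trans by blast
        then have "[i' = l'] (mod int N)" by (simp only: cong_add_rcancel)
        with h 1 show ?thesis using A_cong by simp
      next
        case (2 x' i')
        then show ?thesis using X rot_funpow_B A_neq_B by metis
      qed
      have M_B: "?M (B x i) = prod.swap (?M (A x i))" for x using M_swap[of "A x i"] by (simp add: swap_A)
      have KBi: "?K (B 0 i) = A y l'" unfolding M_B MAi by simp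
      have "(T ^^ N) (?K (B (0 - s) i)) = A y l'"
        using K_Tm[OF B_arc, of N 0 i] unfolding T_funpow_N_B KBi .
      then have "(fst (?K (B (0 - s) i)) + S l') mod int v = y mod int v"
      proof (cases rule: arc_cases[OF K_arc[OF B_arc[of "0 - s" i]]])
        case (1 x' i')
        assume *: "(T ^^ N) (?K (B (0 - s) i)) = A y l'"
        then have "A (x' + S i') i' = A y l'" using 1 by (simp only: T_funpow_N_A)
        then have h: "[x' + S i' = y] (mod int v)" "[i' = l'] (mod int N)"
          by (simp_all only: A_eq)
        then have "(x' + S l') mod int v = y mod int v" using S_cong[OF h(2)] by (simp only: cong_def)
        then show ?thesis unfolding 1 fst_A by (simp add: mod_simps)
      next
        case (2 x' i')
        assume *: "(T ^^ N) (?K (B (0 - s) i)) = A y l'"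
        then show ?thesis using 2 A_neq_B by (metis T_funpow_N_B)
      qed
      moreover have "fst (?K (B (0 - s) i)) = \<sigma> ((- s) mod int v)"
        by (simp add: B_def)
      ultimately have "(\<sigma> ((- s) mod int v) + S l') mod int v = \<sigma> 0" using y by simp
      then have "(\<sigma> ((- s) mod int v) + S l' - S l') mod int v = (\<sigma> 0 - S l') mod int v"
        by (metis mod_diff_left_eq)
      moreover have "\<sigma> ((- s) mod int v) \<in> Zmod v"
        using arc[OF B_arc[of "- s" 0]] by (auto simp: B_def arc_ends)
      ultimately show ?thesis by (simp add: Zmod_def)
    qed
    then have "(\<sigma> 0 - S a) mod int v = (\<sigma> 0 - S b) mod int v" by metis
    then have "[\<sigma> 0 - S a = \<sigma> 0 - S b] (mod int v)" by (simp only: cong_def)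
    then have "int v dvd S b - S a" by (simp add: cong_iff_dvd_diff)
    then have "[S a = S b] (mod int v)" by (simp add: cong_iff_dvd_diff dvd_diff_commute)
    then show False using uneven by blast
  qed
qed

lemma Aut_rot:
  assumes f0: "[f 0 = a0 * s] (mod int v)" and f1: "[f 1 = a1 * s] (mod int v)"
    and uneven: "\<not> [S a = S b] (mod int v)"
  shows "Aut (\<Gamma>, rot) = translation v ` Zmod v"
proof (intro set_eqI iffI)
  \<comment> \<open>\<open>f 0\<close> is a multiple of \<open>s\<close> outside J, so
    \<open>s\<close> is outside J too.\<close>
  have s: "\<not> int w dvd s"
  proof
    assume "int w dvd s"
    moreover have "[f 0 = a0 * s] (mod int w)" using f0 w_dvd_v by (rule cong_dvd_modulus)
    ultimately have "int w dvd f 0" by (simp add: cong_dvd_iff)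
    then show False using not_J by blast
  qed
  fix \<sigma> assume "\<sigma> \<in> Aut (\<Gamma>, rot)"
  then have perm: "\<sigma> permutes Zmod v" and iso: "embedding_isomorphism \<sigma> (\<Gamma>, rot) (\<Gamma>, rot)"
    by (simp_all add: Aut_def)
  have arc: "map_prod \<sigma> \<sigma> e \<in> parcs \<Gamma>" if "e \<in> parcs \<Gamma>" for e
  proof -
    obtain x y where "e = (x, y)" by force
    then show ?thesis
      using that iso arc_ends by (auto simp: embedding_isomorphism_def graph_isomorphism_def)
  qed
  have zero: "0 \<in> Zmod v" using v_pos by (simp add: Zmod_def)
  from iso consider
      (pres) "\<forall>e \<in> parcs \<Gamma>. map_prod \<sigma> \<sigma> (rot e) = rot (map_prod \<sigma> \<sigma> e)"
    | (rev) "\<forall>e \<in> parcs \<Gamma>. map_prod \<sigma> \<sigma> (rot e) = inv rot (map_prod \<sigma> \<sigma> e)"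
    by (auto simp: embedding_isomorphism_def)
  then show "\<sigma> \<in> translation v ` Zmod v"
  proof cases
    case pres
    have "\<sigma> z = (z + \<sigma> 0) mod int v" if "z \<in> Zmod v" for z
      by (rule aut_preserving[OF arc _ s uneven that]) (use pres in blast)+
    moreover have "\<sigma> z = z" if "z \<notin> Zmod v" for z using perm that by (simp add: permutes_def)
    ultimately have "\<sigma> = translation v (\<sigma> 0)" by (auto simp: translation_def)
    moreover have "\<sigma> 0 \<in> Zmod v" using permutes_in_image[OF perm] zero by blast
    ultimately show ?thesis by blast
  next
    case rev
    have "rot (map_prod \<sigma> \<sigma> (rot e)) = map_prod \<sigma> \<sigma> e" if "e \<in> parcs \<Gamma>" for e
      using rev that permutes_inverses(1)[OF rot_permutes] by simp
    then show ?thesis using aut_reversing[OF arc _ f0 f1 uneven] by blast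
  qed
next
  fix \<sigma> assume "\<sigma> \<in> translation v ` Zmod v"
  then obtain g where \<sigma>: "\<sigma> = translation v g" by blast
  have perm: "\<sigma> permutes Zmod v" unfolding \<sigma> by (rule translation_permutes[OF v_pos])
  have in_Zmod: "fst e \<in> Zmod v \<and> snd e \<in> Zmod v" if "e \<in> parcs \<Gamma>" for e
    using that arc_ends by (cases e) auto
  have M: "map_prod \<sigma> \<sigma> e = \<tau> g e" if "e \<in> parcs \<Gamma>" for e
    using in_Zmod[OF that] by (cases e) (simp add: \<sigma> translation_def)
  have "\<forall>e \<in> parcs \<Gamma>. map_prod \<sigma> \<sigma> (rot e) = rot (map_prod \<sigma> \<sigma> e)"
    by (simp add: M rot_arc translate_rot)
  moreover have "(x, y) \<in> parcs \<Gamma> \<longleftrightarrow> (\<sigma> x, \<sigma> y) \<in> parcs \<Gamma>" if "x \<in> Zmod v" "y \<in> Zmod v" for x y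
    using that permutes_in_image[OF perm] dvd_mod_diff_iff[of "x + g" "y + g"]
    by (simp add: arc_ends) (simp add: \<sigma> translation_def)
  ultimately show "\<sigma> \<in> Aut (\<Gamma>, rot)"
    using perm permutes_imp_bij[OF perm]
    by (simp add: Aut_def embedding_isomorphism_def graph_isomorphism_def)
qed

end

subsection \<open>The size of isomorphism classes\<close>

text \<open>Both alternatives of \<open>embedding_isomorphism\<close> are treated at once by a sign:
  \<open>True\<close> keeps the orientation, \<open>False\<close> reverses it, and signs multiply by
  Boolean equality.\<close>

definition signed :: "bool \<Rightarrow> ('a \<Rightarrow> 'a) \<Rightarrow> 'a \<Rightarrow> 'a" where
  "signed b \<rho> = (if b then \<rho> else inv \<rho>)"

definition signed_iso ::
    "'a pair_pre_digraph \<Rightarrow> bool \<Rightarrow> ('a \<Rightarrow> 'a) \<Rightarrow> ('a \<times> 'a \<Rightarrow> 'a \<times> 'a) \<Rightarrow> ('a \<times> 'a \<Rightarrow> 'a \<times> 'a) \<Rightarrow> bool" where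
  "signed_iso G b \<sigma> \<rho> \<rho>' \<longleftrightarrow> graph_isomorphism \<sigma> G G \<and>
     (\<forall>e \<in> parcs G. map_prod \<sigma> \<sigma> (\<rho> e) = signed b \<rho>' (map_prod \<sigma> \<sigma> e))"

lemma embedding_isomorphism_iff:
  "embedding_isomorphism \<sigma> (G, \<rho>) (G, \<rho>') \<longleftrightarrow> (\<exists>b. signed_iso G b \<sigma> \<rho> \<rho>')"
proof -
  have "(\<exists>b. signed_iso G b \<sigma> \<rho> \<rho>') \<longleftrightarrow> signed_iso G True \<sigma> \<rho> \<rho>' \<or> signed_iso G False \<sigma> \<rho> \<rho>'"
    by (metis (full_types))
  then show ?thesis by (auto simp: embedding_isomorphism_def signed_iso_def signed_def)
qed

lemma signed_permutes: "\<rho> permutes E \<Longrightarrow> signed b \<rho> permutes E"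
  by (simp add: signed_def permutes_inv)

lemma signed_eqD:
  assumes "\<rho> permutes E" "\<rho>' permutes E" "\<And>e. e \<in> E \<Longrightarrow> signed b \<rho> e = signed b \<rho>' e"
  shows "\<rho> = \<rho>'"
proof -
  have "signed b \<rho> = signed b \<rho>'"
    using assms signed_permutes permutes_not_in by (metis ext)
  then have "\<rho> = \<rho>' \<or> inv \<rho> = inv \<rho>'" by (simp add: signed_def split: if_splits)
  then show ?thesis
    using permutes_inv_inv[OF assms(1)] permutes_inv_inv[OF assms(2)] by metis
qed

locale arcs_within =
  fixes G :: "'a pair_pre_digraph"
  assumes arcs_within: "parcs G \<subseteq> pverts G \<times> pverts G"
begin

lemma map_arc:
  assumes "graph_isomorphism \<sigma> G G" "e \<in> parcs G"
  shows "map_prod \<sigma> \<sigma> e \<in> parcs G"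
proof -
  obtain x y where e: "e = (x, y)" by force
  then have "x \<in> pverts G" "y \<in> pverts G" using assms(2) arcs_within by auto
  then show ?thesis using assms e by (simp add: graph_isomorphism_def)
qed

lemma map_arc_surj:
  assumes "graph_isomorphism \<sigma> G G" "e' \<in> parcs G"
  obtains e where "e \<in> parcs G" "e' = map_prod \<sigma> \<sigma> e"
proof -
  obtain x' y' where e': "e' = (x', y')" by force
  then have "x' \<in> pverts G" "y' \<in> pverts G" using assms(2) arcs_within by auto
  moreover have "\<sigma> ` pverts G = pverts G"
    using assms(1) by (auto simp: graph_isomorphism_def bij_betw_def)
  ultimately obtain x y where xy: "x \<in> pverts G" "y \<in> pverts G" "x' = \<sigma> x" "y' = \<sigma> y"
    by (metis imageE)
  then have "(x, y) \<in> parcs G" using assms e' by (simp add: graph_isomorphism_def)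
  then show ?thesis using that[of "(x, y)"] e' xy by simp
qed

lemma signed_iso_signed:
  assumes iso: "signed_iso G b \<sigma> \<rho> \<rho>'" and \<rho>: "\<rho> permutes parcs G" and \<rho>': "\<rho>' permutes parcs G"
    and e: "e \<in> parcs G"
  shows "map_prod \<sigma> \<sigma> (signed c \<rho> e) = signed (b = c) \<rho>' (map_prod \<sigma> \<sigma> e)"
proof (cases c)
  case True
  then show ?thesis using iso e by (simp add: signed_iso_def signed_def)
next
  case False
  define e1 where "e1 = inv \<rho> e"
  have e1: "e1 \<in> parcs G" "\<rho> e1 = e"
    unfolding e1_def using e permutes_in_image[OF permutes_inv[OF \<rho>]] permutes_inverses(1)[OF \<rho>]
    by blast+
  then have "map_prod \<sigma> \<sigma> e = signed b \<rho>' (map_prod \<sigma> \<sigma> e1)"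
    using iso unfolding signed_iso_def by blast
  then have "signed (\<not> b) \<rho>' (map_prod \<sigma> \<sigma> e) = map_prod \<sigma> \<sigma> e1"
    using permutes_inverses[OF \<rho>'] by (simp add: signed_def)
  then show ?thesis using False by (simp add: signed_def e1_def)
qed

lemma signed_iso_comp:
  assumes "signed_iso G b \<sigma> \<rho> \<rho>'" "signed_iso G c \<sigma>' \<rho>' \<rho>''"
    and "\<rho>' permutes parcs G" "\<rho>'' permutes parcs G"
  shows "signed_iso G (c = b) (\<sigma>' \<circ> \<sigma>) \<rho> \<rho>''"
proof -
  have g: "graph_isomorphism \<sigma> G G" "graph_isomorphism \<sigma>' G G"
    using assms by (simp_all add: signed_iso_def)
  have "\<sigma> x \<in> pverts G" if "x \<in> pverts G" for x
    using g(1) that bij_betwE unfolding graph_isomorphism_def by blast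
  then have "graph_isomorphism (\<sigma>' \<circ> \<sigma>) G G"
    using g bij_betw_trans[of \<sigma> "pverts G" "pverts G" \<sigma>'] unfolding graph_isomorphism_def o_apply by simp
  moreover have "map_prod (\<sigma>' \<circ> \<sigma>) (\<sigma>' \<circ> \<sigma>) (\<rho> e) =
      signed (c = b) \<rho>'' (map_prod (\<sigma>' \<circ> \<sigma>) (\<sigma>' \<circ> \<sigma>) e)" if "e \<in> parcs G" for e
  proof -
    have "map_prod \<sigma> \<sigma> (\<rho> e) = signed b \<rho>' (map_prod \<sigma> \<sigma> e)"
      using assms(1) that unfolding signed_iso_def by blast
    then have "map_prod \<sigma>' \<sigma>' (map_prod \<sigma> \<sigma> (\<rho> e)) =
        signed (c = b) \<rho>'' (map_prod \<sigma>' \<sigma>' (map_prod \<sigma> \<sigma> e))"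
      using signed_iso_signed[OF assms(2-4) map_arc[OF g(1) that]] by simp
    then show ?thesis by (simp only: map_prod.comp[symmetric] o_apply)
  qed
  ultimately show ?thesis by (simp add: signed_iso_def)
qed

text \<open>On the vertices \<open>\<psi>\<close> is the conjugate of \<open>\<tau>\<close> by
  \<open>\<sigma>\<close>. The sign \<open>b\<close> of \<open>\<sigma>\<close> enters twice and
  cancels.\<close>

lemma signed_iso_conj:
  assumes \<sigma>: "signed_iso G b \<sigma> \<rho> \<rho>'" and \<tau>: "signed_iso G c \<tau> \<rho> \<rho>"
    and \<rho>: "\<rho> permutes parcs G" and \<rho>': "\<rho>' permutes parcs G"
    and \<psi>: "\<And>x. x \<in> pverts G \<Longrightarrow> \<psi> (\<sigma> x) = \<sigma> (\<tau> x)"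
  shows "signed_iso G c \<psi> \<rho>' \<rho>'"
proof -
  have g: "graph_isomorphism \<sigma> G G" "graph_isomorphism \<tau> G G"
    using assms by (simp_all add: signed_iso_def)
  have im: "\<sigma> ` pverts G = pverts G" "\<tau> ` pverts G = pverts G"
    and inj: "inj_on \<sigma> (pverts G)" "inj_on \<tau> (pverts G)"
    using g by (auto simp: graph_isomorphism_def bij_betw_def)
  have "graph_isomorphism \<psi> G G"
    unfolding graph_isomorphism_def
  proof
    have "\<psi> ` \<sigma> ` pverts G = (\<sigma> \<circ> \<tau>) ` pverts G" using \<psi> by (auto simp: image_iff)
    then have "\<psi> ` pverts G = pverts G" by (simp only: image_comp[symmetric] im)
    moreover have "inj_on \<psi> (pverts G)"
    proof (rule inj_onI)
      fix x y assume "x \<in> pverts G" "y \<in> pverts G" "\<psi> x = \<psi> y"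
      then obtain x' y' where h: "x' \<in> pverts G" "y' \<in> pverts G" "x = \<sigma> x'" "y = \<sigma> y'"
        using im by (metis imageE)
      then have "\<sigma> (\<tau> x') = \<sigma> (\<tau> y')" using \<open>\<psi> x = \<psi> y\<close> \<psi> by simp
      then have "\<tau> x' = \<tau> y'" using inj(1) h im(2) by (metis imageI inj_onD)
      then show "x = y" using inj(2) h by (metis inj_onD)
    qed
    ultimately show "bij_betw \<psi> (pverts G) (pverts G)" by (simp add: bij_betw_def)
    show "\<forall>x\<in>pverts G. \<forall>y\<in>pverts G. ((x, y) \<in> parcs G) = ((\<psi> x, \<psi> y) \<in> parcs G)"
    proof (intro ballI)
      fix x y assume "x \<in> pverts G" "y \<in> pverts G"
      then obtain x' y' where h: "x' \<in> pverts G" "y' \<in> pverts G" "x = \<sigma> x'" "y = \<sigma> y'"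
        using im by (metis imageE)
      then have t: "\<tau> x' \<in> pverts G" "\<tau> y' \<in> pverts G" using im by auto
      have "(x, y) \<in> parcs G \<longleftrightarrow> (x', y') \<in> parcs G" using g(1) h by (simp add: graph_isomorphism_def)
      also have "\<dots> \<longleftrightarrow> (\<tau> x', \<tau> y') \<in> parcs G" using g(2) h by (simp add: graph_isomorphism_def)
      also have "\<dots> \<longleftrightarrow> (\<sigma> (\<tau> x'), \<sigma> (\<tau> y')) \<in> parcs G" using g(1) t by (simp add: graph_isomorphism_def)
      finally show "((x, y) \<in> parcs G) = ((\<psi> x, \<psi> y) \<in> parcs G)" using \<psi> h by simp
    qed
  qed
  moreover have "map_prod \<psi> \<psi> (\<rho>' e') = signed c \<rho>' (map_prod \<psi> \<psi> e')" if e': "e' \<in> parcs G" for e'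
  proof -
    have M: "map_prod \<psi> \<psi> (map_prod \<sigma> \<sigma> e) = map_prod \<sigma> \<sigma> (map_prod \<tau> \<tau> e)" if "e \<in> parcs G" for e
      using that arcs_within \<psi> by (cases e) auto
    obtain e where e: "e \<in> parcs G" "e' = map_prod \<sigma> \<sigma> e" by (rule map_arc_surj[OF g(1) e'])
    have se: "signed b \<rho> e \<in> parcs G" using e permutes_in_image[OF signed_permutes[OF \<rho>]] by blast
    have "\<rho>' e' = map_prod \<sigma> \<sigma> (signed b \<rho> e)"
      using signed_iso_signed[OF \<sigma> \<rho> \<rho>' e(1), of b] by (simp add: e signed_def)
    then have "map_prod \<psi> \<psi> (\<rho>' e') = map_prod \<sigma> \<sigma> (map_prod \<tau> \<tau> (signed b \<rho> e))"
      using M se by simp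
    also have "\<dots> = map_prod \<sigma> \<sigma> (signed (c = b) \<rho> (map_prod \<tau> \<tau> e))"
      using signed_iso_signed[OF \<tau> \<rho> \<rho> e(1)] by simp
    also have "\<dots> = signed (b = (c = b)) \<rho>' (map_prod \<sigma> \<sigma> (map_prod \<tau> \<tau> e))"
      by (rule signed_iso_signed[OF \<sigma> \<rho> \<rho>' map_arc[OF g(2) e(1)]])
    also have "\<dots> = signed (b = (c = b)) \<rho>' (map_prod \<psi> \<psi> e')" by (simp only: M[OF e(1)] e(2))
    also have "(b = (c = b)) = c" by auto
    finally show ?thesis .
  qed
  ultimately show ?thesis by (simp add: signed_iso_def)
qed

end

lemma arcs_within_complete_multipartite: "arcs_within (complete_multipartite v t)"
  by unfold_locales (auto simp: complete_multipartite_def)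

lemma cyclic_biembeddingsD:
  assumes "(G, \<rho>) \<in> cyclic_biembeddings v t k"
  shows "G = complete_multipartite v t" "\<rho> permutes parcs G"
    "Aut (G, \<rho>) = translation v ` Zmod v"
proof -
  have *: "biembedding (G, \<rho>)" "G = complete_multipartite v t" "Aut (G, \<rho>) = translation v ` Zmod v"
    using assms unfolding cyclic_biembeddings_def mem_Collect_eq fst_conv by iprover+
  then have "embedding (G, \<rho>)" unfolding biembedding_def by iprover
  then show "\<rho> permutes parcs G" unfolding embedding_def prod.case by iprover
  show "G = complete_multipartite v t" "Aut (G, \<rho>) = translation v ` Zmod v" by fact+
qed

lemma cyclic_biembeddingsE:
  assumes "Q \<in> cyclic_biembeddings v t k"
  obtains \<rho> where "Q = (complete_multipartite v t, \<rho>)"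
proof -
  obtain G \<rho> where Q: "Q = (G, \<rho>)" by force
  have "G = complete_multipartite v t" by (rule cyclic_biembeddingsD(1)[OF assms[unfolded Q]])
  then show ?thesis using that Q by blast
qed

lemma signed_iso_translation:
  assumes "(G, \<rho>) \<in> cyclic_biembeddings v t k" "g \<in> Zmod v"
  obtains b where "signed_iso G b (translation v g) \<rho> \<rho>"
proof -
  have "translation v g \<in> Aut (G, \<rho>)" using cyclic_biembeddingsD(3)[OF assms(1)] assms(2) by simp
  then show ?thesis using that by (auto simp: Aut_def embedding_isomorphism_iff)
qed

text \<open>Both automorphism groups consist of the translations, so conjugation by
  \<open>\<sigma>\<close> turns \<open>x \<mapsto> x + 1\<close> into a translation by some
  \<open>u\<close>, whence \<open>\<sigma> (x + 1) = \<sigma> x + u\<close>. Since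
  \<open>\<sigma>\<close> attains the value \<open>\<sigma> 0 + 1\<close>, \<open>u\<close> is a
  unit.\<close>

lemma iso_is_affine:
  assumes v: "v > 1"
    and P: "(G, \<rho>) \<in> cyclic_biembeddings v t k" and Q: "(G, \<rho>') \<in> cyclic_biembeddings v t k"
    and iso: "signed_iso G b \<sigma> \<rho> \<rho>'"
  shows "\<exists>u \<in> totatives v. \<forall>x \<in> Zmod v. \<sigma> x = (\<sigma> 0 + int u * x) mod int v"
proof -
  have G: "G = complete_multipartite v t" by (rule cyclic_biembeddingsD(1)[OF P])
  interpret arcs_within G unfolding G by (rule arcs_within_complete_multipartite)
  have verts: "pverts G = Zmod v" by (simp add: G)
  have bij: "bij_betw \<sigma> (Zmod v) (Zmod v)"
    using iso by (simp add: signed_iso_def graph_isomorphism_def verts)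
  have in_Z: "\<sigma> x \<in> Zmod v" if "x \<in> Zmod v" for x using bij that bij_betwE by blast
  have one: "1 \<in> Zmod v" and zero: "0 \<in> Zmod v" using v by (simp_all add: Zmod_def)
  define \<tau> where "\<tau> = translation v 1"
  have \<tau>_in: "\<tau> x \<in> Zmod v" if "x \<in> Zmod v" for x
    using that v by (simp add: \<tau>_def translation_def Zmod_def)
  \<comment> \<open>Extended by the identity outside \<open>Zmod v\<close>, as membership in
    \<open>Aut\<close> demands.\<close>
  define \<psi> where "\<psi> x = (if x \<in> Zmod v then \<sigma> (\<tau> (inv_into (Zmod v) \<sigma> x)) else x)" for x
  have \<psi>: "\<psi> (\<sigma> x) = \<sigma> (\<tau> x)" if "x \<in> Zmod v" for x
    using that in_Z bij by (simp add: \<psi>_def bij_betw_inv_into_left)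
  obtain c where c: "signed_iso G c \<tau> \<rho> \<rho>"
    unfolding \<tau>_def by (rule signed_iso_translation[OF P one])
  have \<psi>_iso: "signed_iso G c \<psi> \<rho>' \<rho>'"
    by (rule signed_iso_conj[OF iso c cyclic_biembeddingsD(2)[OF P] cyclic_biembeddingsD(2)[OF Q]])
      (simp add: verts \<psi>)
  then have "\<psi> permutes Zmod v"
    by (intro bij_imp_permutes) (simp_all add: signed_iso_def graph_isomorphism_def verts \<psi>_def)
  then have "\<psi> \<in> Aut (G, \<rho>')"
    using \<psi>_iso by (auto simp: Aut_def verts embedding_isomorphism_iff)
  then obtain u where u: "u \<in> Zmod v" "\<psi> = translation v u"
    using cyclic_biembeddingsD(3)[OF Q] by blast
  have step: "\<sigma> ((x + 1) mod int v) = (\<sigma> x + u) mod int v" if "x \<in> Zmod v" for x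
    using \<psi>[OF that] in_Z[OF that] that by (simp add: u(2) \<tau>_def translation_def)
  have pow: "\<sigma> (int m mod int v) = (\<sigma> 0 + u * int m) mod int v" for m
  proof (induction m)
    case 0
    then show ?case using in_Z[OF zero] by (simp add: Zmod_def)
  next
    case (Suc m)
    have "int m mod int v \<in> Zmod v" using v by (simp add: Zmod_def)
    from step[OF this] show ?case unfolding Suc by (simp add: mod_simps algebra_simps)
  qed
  have aff: "\<sigma> x = (\<sigma> 0 + u * x) mod int v" if "x \<in> Zmod v" for x
    using pow[of "nat x"] that by (simp add: Zmod_def)
  have "(\<sigma> 0 + 1) mod int v \<in> Zmod v" using v by (simp add: Zmod_def)
  then obtain x where x: "x \<in> Zmod v" "\<sigma> x = (\<sigma> 0 + 1) mod int v"
    using bij by (metis bij_betw_imp_surj_on imageE)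
  then have "[\<sigma> 0 + u * x = \<sigma> 0 + 1] (mod int v)" using aff by (simp add: cong_def)
  then have "[u * x = 1] (mod int v)" by (simp only: cong_add_lcancel)
  then have "coprime u (int v)" using coprime_iff_invertible_int by blast
  moreover have u': "u = int (nat u)" using u(1) by (simp add: Zmod_def)
  ultimately have cop: "coprime (nat u) v" by (metis coprime_int_iff)
  then have "nat u > 0" using v by (cases "nat u") auto
  then have "nat u \<in> totatives v" using cop u(1) by (auto simp: totatives_def Zmod_def)
  then show ?thesis using aff u' by metis
qed

lemma finite_cyclic_biembeddings: "finite (cyclic_biembeddings v t k)"
proof (rule finite_subset)
  let ?G = "complete_multipartite v t"
  show "cyclic_biembeddings v t k \<subseteq> {?G} \<times> {\<rho>. \<rho> permutes parcs ?G}"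
  proof
    fix P assume "P \<in> cyclic_biembeddings v t k"
    then obtain \<rho> where \<rho>: "P = (?G, \<rho>)" by (rule cyclic_biembeddingsE)
    then have "\<rho> permutes parcs ?G" using cyclic_biembeddingsD(2) \<open>P \<in> _\<close> by metis
    then show "P \<in> {?G} \<times> {\<rho>. \<rho> permutes parcs ?G}" by (simp add: \<rho>)
  qed
  show "finite ({?G} \<times> {\<rho>. \<rho> permutes parcs ?G})"
    by (simp add: finite_permutations)
qed

text \<open>Composing with a translation, which is an automorphism of the target, makes the
  isomorphism fix 0. It is then multiplication by a unit, and \<open>Q\<close> is determined by that
  unit and the sign.\<close>

lemma card_iso_class_le:
  assumes v: "v > 1" and P: "P \<in> cyclic_biembeddings v t k"
  shows "card {Q \<in> cyclic_biembeddings v t k. \<exists>\<sigma>. embedding_isomorphism \<sigma> P Q} \<le> 2 * totient v"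
proof -
  let ?S = "cyclic_biembeddings v t k"
  obtain G \<rho> where P_eq: "P = (G, \<rho>)" by force
  note P' = P[unfolded P_eq]
  have G: "G = complete_multipartite v t" by (rule cyclic_biembeddingsD(1)[OF P'])
  interpret arcs_within G unfolding G by (rule arcs_within_complete_multipartite)
  let ?C = "{Q \<in> ?S. \<exists>\<sigma>. embedding_isomorphism \<sigma> P Q}"
  let ?R = "\<lambda>Q (u, b). u \<in> totatives v \<and>
    (\<exists>\<sigma>. signed_iso G b \<sigma> \<rho> (snd Q) \<and> (\<forall>x \<in> Zmod v. \<sigma> x = (int u * x) mod int v))"
  have verts: "pverts G = Zmod v" by (simp add: G)
  have zero: "0 \<in> Zmod v" using v by (simp add: Zmod_def)
  have ex: "\<exists>p. ?R Q p" if "Q \<in> ?C" for Q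
  proof -
    have "Q \<in> ?S" using that by blast
    then obtain \<rho>' where Q: "Q = (G, \<rho>')" unfolding G by (rule cyclic_biembeddingsE)
    from that obtain \<sigma> where "embedding_isomorphism \<sigma> P Q" by blast
    then obtain b where iso: "signed_iso G b \<sigma> \<rho> \<rho>'"
      unfolding P_eq Q embedding_isomorphism_iff by blast
    have Q': "(G, \<rho>') \<in> ?S" using that Q by simp
    obtain u where u: "u \<in> totatives v" "\<And>x. x \<in> Zmod v \<Longrightarrow> \<sigma> x = (\<sigma> 0 + int u * x) mod int v"
      using iso_is_affine[OF v P' Q' iso] by blast
    define g where "g = (- \<sigma> 0) mod int v"
    have "g \<in> Zmod v" using v by (simp add: g_def Zmod_def)
    \<comment> \<open>\<open>Aut\<close> admits both orientations, so the translation that moves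
      \<open>\<sigma> 0\<close> back to 0 comes with a sign \<open>c\<close> of its own.\<close>
    then obtain c where c: "signed_iso G c (translation v g) \<rho>' \<rho>'"
      using signed_iso_translation[OF Q'] by blast
    have "signed_iso G (c = b) (translation v g \<circ> \<sigma>) \<rho> \<rho>'"
      by (rule signed_iso_comp[OF iso c cyclic_biembeddingsD(2)[OF Q'] cyclic_biembeddingsD(2)[OF Q']])
    moreover have "(translation v g \<circ> \<sigma>) x = (int u * x) mod int v" if "x \<in> Zmod v" for x
    proof -
      have "\<sigma> x \<in> Zmod v" unfolding u(2)[OF that] using v by (simp add: Zmod_def)
      then have "(translation v g \<circ> \<sigma>) x = (\<sigma> x + g) mod int v" by (simp add: translation_def)
      also have "\<dots> = ((\<sigma> 0 + int u * x) mod int v + g) mod int v" by (simp only: u(2)[OF that])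
      also have "\<dots> = (int u * x) mod int v" by (simp add: g_def mod_simps)
      finally show ?thesis .
    qed
    ultimately have "?R Q (u, c = b)" unfolding prod.case Q snd_conv using u(1) by blast
    then show ?thesis ..
  qed
  define h where "h Q = (SOME p. ?R Q p)" for Q :: "int rotated_graph"
  have h: "?R Q (h Q)" if "Q \<in> ?C" for Q
    unfolding h_def by (rule someI_ex[OF ex[OF that]])
  have h_inj: "inj_on h ?C"
  proof (rule inj_onI)
    fix Q Q' assume Q: "Q \<in> ?C" and Q': "Q' \<in> ?C" and eq: "h Q = h Q'"
    obtain u b where ub: "h Q = (u, b)" by force
    have ub1: "?R Q (u, b)" using h[OF Q] unfolding ub .
    have ub2: "?R Q' (u, b)" using h[OF Q'] unfolding eq[symmetric] ub .
    have "Q \<in> ?S" "Q' \<in> ?S" using Q Q' by blast+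
    then obtain \<rho>1 \<rho>2 where Q1: "Q = (G, \<rho>1)" and Q2: "Q' = (G, \<rho>2)"
      unfolding G by (elim cyclic_biembeddingsE)
    obtain \<sigma>1 where \<sigma>1: "signed_iso G b \<sigma>1 \<rho> \<rho>1" "\<forall>x \<in> Zmod v. \<sigma>1 x = (int u * x) mod int v"
      using ub1 unfolding Q1 prod.case snd_conv by blast
    obtain \<sigma>2 where \<sigma>2: "signed_iso G b \<sigma>2 \<rho> \<rho>2" "\<forall>x \<in> Zmod v. \<sigma>2 x = (int u * x) mod int v"
      using ub2 unfolding Q2 prod.case snd_conv by blast
    have \<rho>: "\<rho> permutes parcs G" by (rule cyclic_biembeddingsD(2)[OF P'])
    have \<rho>1: "\<rho>1 permutes parcs G" using Q unfolding Q1 by (blast intro: cyclic_biembeddingsD(2))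
    have \<rho>2: "\<rho>2 permutes parcs G" using Q' unfolding Q2 by (blast intro: cyclic_biembeddingsD(2))
    have M: "map_prod \<sigma>1 \<sigma>1 e = map_prod \<sigma>2 \<sigma>2 e" if "e \<in> parcs G" for e
      using that arcs_within \<sigma>1(2) \<sigma>2(2) unfolding verts by (cases e) auto
    have "\<rho>1 = \<rho>2"
    proof (rule signed_eqD[OF \<rho>1 \<rho>2, of b])
      fix e' assume e': "e' \<in> parcs G"
      have "graph_isomorphism \<sigma>1 G G" using \<sigma>1 by (simp add: signed_iso_def)
      then obtain e where e: "e \<in> parcs G" "e' = map_prod \<sigma>1 \<sigma>1 e" using map_arc_surj e' by blast
      have "\<rho> e \<in> parcs G" using permutes_in_image[OF \<rho>] e by blast
      then have "signed b \<rho>1 (map_prod \<sigma>1 \<sigma>1 e) = signed b \<rho>2 (map_prod \<sigma>2 \<sigma>2 e)"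
        using \<sigma>1(1) \<sigma>2(1) M e(1) by (metis signed_iso_def)
      then show "signed b \<rho>1 e' = signed b \<rho>2 e'" using M e by simp
    qed
    then show "Q = Q'" by (simp add: Q1 Q2)
  qed
  have "h Q \<in> totatives v \<times> UNIV" if "Q \<in> ?C" for Q
    using h[OF that] by (cases "h Q") simp
  then have "h ` ?C \<subseteq> totatives v \<times> UNIV" by blast
  then have "card ?C \<le> card (totatives v \<times> (UNIV :: bool set))"
    by (intro card_inj_on_le[OF h_inj]) simp_all
  then show ?thesis by (simp add: card_cartesian_product totient_def)
qed

text \<open>Reflexivity makes the images of single points cover \<open>S\<close>, and a union is at
  most as large as the sum of the sizes.\<close>

lemma card_le_card_quotient:
  assumes fin: "finite S"
    and refl: "\<And>x. x \<in> S \<Longrightarrow> (x, x) \<in> r"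
    and r: "r \<subseteq> S \<times> S"
    and le: "\<And>x. x \<in> S \<Longrightarrow> card (r `` {x}) \<le> c"
  shows "card S \<le> card (S // r) * c"
proof -
  have "S \<subseteq> \<Union> (S // r)"
  proof
    fix x assume "x \<in> S"
    then have "r `` {x} \<in> S // r" "x \<in> r `` {x}" using refl quotientI by auto
    then show "x \<in> \<Union> (S // r)" by (rule UnionI)
  qed
  moreover have "\<Union> (S // r) \<subseteq> S" using r by (auto simp: quotient_def)
  ultimately have "card S \<le> card (\<Union> (S // r))" using fin finite_subset by (intro card_mono) auto
  also have "\<dots> \<le> (\<Sum>C \<in> S // r. card C)" by (rule card_Union_le_sum_card)
  also have "\<dots> \<le> card (S // r) * c"
    using sum_bounded_above[of "S // r" card c] le by (force elim: quotientE)
  finally show ?thesis .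
qed

lemma card_iso_classes_ge:
  assumes v: "v > 1"
  shows "card (cyclic_biembeddings v t k) \<le> card (iso_classes (cyclic_biembeddings v t k)) * (2 * totient v)"
  unfolding iso_classes_def
proof (rule card_le_card_quotient[OF finite_cyclic_biembeddings])
  let ?S = "cyclic_biembeddings v t k"
  fix P assume P: "P \<in> ?S"
  have "embedding_isomorphism id P P"
    by (cases P) (simp add: embedding_isomorphism_def graph_isomorphism_def prod.map_id0)
  with P show "(P, P) \<in> {(P, Q). P \<in> ?S \<and> Q \<in> ?S \<and> (\<exists>\<sigma>. embedding_isomorphism \<sigma> P Q)}"
    unfolding mem_Collect_eq prod.case by blast
  have "{(P, Q). P \<in> ?S \<and> Q \<in> ?S \<and> (\<exists>\<sigma>. embedding_isomorphism \<sigma> P Q)} `` {P}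
      = {Q \<in> ?S. \<exists>\<sigma>. embedding_isomorphism \<sigma> P Q}"
    unfolding Image_singleton mem_Collect_eq prod.case using P by (simp only: simp_thms)
  then show "card ({(P, Q). P \<in> ?S \<and> Q \<in> ?S \<and> (\<exists>\<sigma>. embedding_isomorphism \<sigma> P Q)} `` {P})
      \<le> 2 * totient v"
    using card_iso_class_le[OF v P] by (simp only:)
qed (use subsetI in blast)

subsection \<open>Labellings by signed half-systems\<close>

text \<open>Serves to prescribe the labels in positions 0 to 3.\<close>

lemma ex_bij_betw_extending_list:
  assumes "finite A" "distinct xs" "set xs \<subseteq> A"
  shows "\<exists>b. bij_betw b {..<card A} A \<and> (\<forall>i < length xs. b i = xs ! i)"
proof -
  obtain ys where ys: "set ys = A - set xs" "distinct ys"
    using finite_distinct_list[of "A - set xs"] assms(1) by auto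
  let ?zs = "xs @ ys"
  have d: "distinct ?zs" and s: "set ?zs = A" using ys assms by auto
  then have "length ?zs = card A" by (metis distinct_card)
  then have "bij_betw (\<lambda>i. ?zs ! i) {..<card A} A" using d s by (intro bij_betw_nth) auto
  moreover have "\<forall>i < length xs. ?zs ! i = xs ! i" by (simp add: nth_append)
  ultimately show ?thesis by blast
qed

lemma small_cong_imp_eq:
  fixes a b :: int
  assumes "[a = b] (mod m)" "2 * \<bar>a\<bar> < m" "2 * \<bar>b\<bar> < m"
  shows "a = b"
proof -
  have "\<bar>a - b\<bar> < m" using assms(2,3) by linarith
  moreover have "m dvd a - b" using assms(1) by (simp add: cong_iff_dvd_diff)
  ultimately show ?thesis using zdvd_not_zless[of "\<bar>a - b\<bar>" m] by force
qed

text \<open>With \<open>w > 24\<close> the sign change of the label 2 alters six times the sum by a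
  number outside J, and 1 to 4 are labels whose signed differences are outside J unless they vanish.
  \<open>N \<ge> 20\<close> is for the factorial estimate.\<close>

locale half_system =
  fixes t N w v :: nat
  assumes v_eq: "v = w * t" and N_eq: "2 * N = (w - 1) * t" and t_pos: "t > 0"
    and w_gt: "w > 24" and N_ge: "N \<ge> 20"
begin

definition H :: "int set" where "H = {h. 0 < h \<and> 2 * h < int v \<and> \<not> int w dvd h}"

definition sgnd :: "int set \<Rightarrow> int \<Rightarrow> int" where "sgnd D h = (if h \<in> D then - h else h)"

definition label :: "int set \<Rightarrow> (nat \<Rightarrow> int) \<Rightarrow> int \<Rightarrow> int" where
  "label D b i = sgnd D (b (nat (i mod int N)))"

lemma v_minus_t: "int v - int t = 2 * int N"
proof -
  have "w * t = (w - 1) * t + t" using w_gt by (cases w) simp_all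
  then have "v = 2 * N + t" by (simp only: v_eq N_eq)
  then show ?thesis by simp
qed

lemma w_dvd_v: "int w dvd int v" using v_eq by simp

lemma v_ge_w: "v \<ge> w" using v_eq t_pos by simp

text \<open>A difference outside J must not be its own negative, or signs could not be chosen. For
  even \<open>t\<close> half of \<open>v\<close> is a multiple of \<open>w\<close>; for odd
  \<open>t\<close> the evenness of \<open>(w - 1) * t\<close> makes \<open>w\<close> and
  \<open>v\<close> odd.\<close>

lemma half_not_J:
  assumes "\<not> int w dvd h"
  shows "2 * h \<noteq> int v"
proof
  assume h: "2 * h = int v"
  show False
  proof (cases "even t")
    case True
    then obtain a where "t = 2 * a" by blast
    then have "h = int w * int a" using h v_eq by simp
    then show False using assms by simp
  next
    case False
    have "even ((w - 1) * t)" using N_eq by (metis dvd_triv_left)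
    then have "even (w - 1)" using False by simp
    then have "odd w" using w_gt by simp
    then have "odd v" using False v_eq by simp
    moreover have "even (int v)" using h by (metis dvd_triv_left)
    ultimately show False by simp
  qed
qed

lemma finite_H: "finite H"
  by (rule finite_subset[of _ "{0..int v}"]) (auto simp: H_def)

lemma H_repr:
  assumes "\<not> int w dvd z"
  shows "\<exists>h \<in> H. [z = h] (mod int v) \<or> [z = - h] (mod int v)"
proof -
  define y where "y = z mod int v"
  have v0: "int v > 0" using v_ge_w w_gt by simp
  have y: "0 \<le> y" "y < int v" using v0 by (simp_all add: y_def)
  have zy: "[z = y] (mod int v)" by (simp add: y_def)
  have wy: "\<not> int w dvd y" using assms w_dvd_v by (simp add: y_def dvd_mod_iff)
  then have "y \<noteq> 0" by auto
  show ?thesis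
  proof (cases "2 * y < int v")
    case True
    then have "y \<in> H" using y wy \<open>y \<noteq> 0\<close> by (simp add: H_def)
    then show ?thesis using zy by blast
  next
    case False
    then have "2 * y > int v" using half_not_J[OF wy] by simp
    moreover have "\<not> int w dvd int v - y" using wy w_dvd_v by (metis dvd_diff diff_diff_eq2 add_diff_cancel_left')
    ultimately have "int v - y \<in> H" using y by (simp add: H_def)
    moreover have "[z = - (int v - y)] (mod int v)" using zy by (simp add: cong_def)
    ultimately show ?thesis by blast
  qed
qed

text \<open>The complement of J in \<open>Zmod v\<close> is the disjoint union of \<open>H\<close>
  and its reflection \<open>h \<mapsto> v - h\<close>, and J has \<open>t\<close> elements.\<close>

lemma card_H: "card H = N"
proof -
  have v0: "int v > 0" using v_ge_w w_gt by simp
  let ?J = "{z \<in> Zmod v. int w dvd z}"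
  have "?J = (\<lambda>y. int w * y) ` {0..<int t}"
  proof (intro set_eqI iffI)
    fix z assume "z \<in> ?J"
    then obtain y where y: "z = int w * y" "0 \<le> z" "z < int v" by (auto simp: Zmod_def)
    then have "0 \<le> y" "y < int t" using w_gt v_eq by (auto simp: zero_le_mult_iff)
    then show "z \<in> (\<lambda>y. int w * y) ` {0..<int t}" using y by auto
  qed (use w_gt v_eq in \<open>auto simp: Zmod_def\<close>)
  moreover have "inj_on (\<lambda>y. int w * y) {0..<int t}" using w_gt by (auto intro!: inj_onI)
  ultimately have cJ: "card ?J = t" by (simp add: card_image)
  have "Zmod v - ?J = H \<union> (\<lambda>h. int v - h) ` H"
  proof (intro set_eqI iffI)
    fix z assume z: "z \<in> Zmod v - ?J"
    then have zz: "0 \<le> z" "z < int v" "\<not> int w dvd z" by (auto simp: Zmod_def)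
    then have "z \<noteq> 0" by auto
    show "z \<in> H \<union> (\<lambda>h. int v - h) ` H"
    proof (cases "2 * z < int v")
      case True
      then show ?thesis using zz \<open>z \<noteq> 0\<close> by (simp add: H_def)
    next
      case False
      then have "2 * z > int v" using half_not_J[OF zz(3)] by simp
      moreover have "\<not> int w dvd int v - z" using zz w_dvd_v by (metis dvd_diff diff_diff_eq2 add_diff_cancel_left')
      ultimately have "int v - z \<in> H" using zz by (simp add: H_def)
      moreover have "z = int v - (int v - z)" by simp
      ultimately show ?thesis by blast
    qed
  next
    fix z assume "z \<in> H \<union> (\<lambda>h. int v - h) ` H"
    then consider "z \<in> H" | h where "h \<in> H" "z = int v - h" by blast
    then show "z \<in> Zmod v - ?J"
    proof cases
      case 1
      then show ?thesis by (auto simp: H_def Zmod_def)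
    next
      case 2
      then have "\<not> int w dvd z" using w_dvd_v dvd_diff[of "int w" "int v" z] by (auto simp: H_def)
      then show ?thesis using 2 by (auto simp: H_def Zmod_def)
    qed
  qed
  moreover have "card (Zmod v - ?J) = v - t"
  proof -
    have "finite ?J" by (rule finite_subset[of _ "Zmod v"]) auto
    then have "card (Zmod v - ?J) = card (Zmod v) - card ?J" by (intro card_Diff_subset) auto
    then show ?thesis using cJ by (simp add: Zmod_def)
  qed
  moreover have "card (H \<union> (\<lambda>h. int v - h) ` H) = card H + card H"
  proof -
    have "H \<inter> (\<lambda>h. int v - h) ` H = {}" by (auto simp: H_def)
    moreover have "card ((\<lambda>h. int v - h) ` H) = card H" by (rule card_image) (auto intro: inj_onI)
    ultimately show ?thesis using finite_H by (simp add: card_Un_disjoint)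
  qed
  ultimately have "2 * card H = v - t" by simp
  then show ?thesis using v_minus_t by linarith
qed

lemma small_mem_H: "0 < h \<Longrightarrow> h \<le> 4 \<Longrightarrow> h \<in> H"
  using v_ge_w w_gt zdvd_not_zless[of h "int w"] by (auto simp: H_def)

lemma abs_sgnd [simp]: "\<bar>sgnd D h\<bar> = \<bar>h\<bar>"
  by (simp add: sgnd_def)

lemma sgnd_cong_cases: "sgnd D h = h \<or> sgnd D h = - h"
  by (simp add: sgnd_def)

lemma H_bounds: "h \<in> H \<Longrightarrow> 0 < h" "h \<in> H \<Longrightarrow> 2 * \<bar>h\<bar> < int v" "h \<in> H \<Longrightarrow> \<not> int w dvd h"
  by (auto simp: H_def)

lemma sgnd_inj:
  assumes "h \<in> H" "h' \<in> H" "sgnd D h = sgnd D h'"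
  shows "h = h'"
proof -
  have "\<bar>h\<bar> = \<bar>h'\<bar>" using assms(3) abs_sgnd by metis
  then show ?thesis using H_bounds(1)[OF assms(1)] H_bounds(1)[OF assms(2)] by linarith
qed

text \<open>All labels are smaller than \<open>v / 2\<close> in absolute value, so congruences
  between them and their negatives are equalities, which the positive elements of \<open>H\<close>
  decide.\<close>

lemma cyclic_labelling_label:
  assumes b: "bij_betw b {..<N} H" and j: "coprime (1 + j) N"
  shows "cyclic_labelling v w t N j (label D b)"
proof
  have N0: "N > 0" using N_ge by simp
  have in_H: "b (nat (i mod int N)) \<in> H" for i
  proof -
    have "nat (i mod int N) < N" using N0 by (simp add: nat_less_iff)
    then show ?thesis using b bij_betwE by blast
  qed
  show "v = w * t" "w > 1" "t > 0" "N > 2" "coprime (1 + j) N"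
    using v_eq w_gt t_pos N_ge j by simp_all
  show "label D b (i mod int N) = label D b i" for i by (simp add: label_def)
  show "[i = i'] (mod int N)" if "[label D b i = label D b i'] (mod int v)" for i i'
  proof -
    have "label D b i = label D b i'"
      by (rule small_cong_imp_eq[OF that]) (simp_all add: label_def H_bounds(2)[OF in_H])
    then have "b (nat (i mod int N)) = b (nat (i' mod int N))"
      unfolding label_def by (rule sgnd_inj[OF in_H in_H])
    moreover have "nat (i mod int N) < N" "nat (i' mod int N) < N"
      using N0 by (simp_all add: nat_less_iff)
    ultimately have "nat (i mod int N) = nat (i' mod int N)"
      using b by (metis bij_betw_def inj_onD lessThan_iff)
    then show ?thesis using N0 by (simp add: cong_def nat_eq_iff)
  qed
  show "\<not> [label D b i = - label D b i'] (mod int v)" for i i'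
  proof
    assume *: "[label D b i = - label D b i'] (mod int v)"
    have eq: "label D b i = - label D b i'"
      by (rule small_cong_imp_eq[OF *]) (simp_all add: label_def H_bounds(2)[OF in_H])
    let ?h = "b (nat (i mod int N))" and ?h' = "b (nat (i' mod int N))"
    from eq have e: "sgnd D ?h = - sgnd D ?h'" by (simp only: label_def)
    then have "\<bar>?h\<bar> = \<bar>?h'\<bar>" using abs_sgnd by (metis abs_minus_cancel)
    then have "?h = ?h'" using H_bounds(1)[OF in_H[of i]] H_bounds(1)[OF in_H[of i']] by linarith
    then have "sgnd D ?h = 0" using e by simp
    then have "\<bar>?h\<bar> = 0" using abs_sgnd[of D ?h] by simp
    then show False using H_bounds(1)[OF in_H[of i]] by simp
  qed
  show "\<not> int w dvd label D b i" for i
    using H_bounds(3)[OF in_H[of i]] by (simp add: label_def sgnd_def)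
  show "\<exists>i. [z = label D b i] (mod int v) \<or> [z = - label D b i] (mod int v)" if z: "\<not> int w dvd z" for z
  proof -
    obtain h where h: "h \<in> H" "[z = h] (mod int v) \<or> [z = - h] (mod int v)" using H_repr[OF z] by blast
    obtain m where m: "m < N" "b m = h" using h(1) b by (metis bij_betw_imp_surj_on imageE lessThan_iff)
    then have "label D b (int m) = sgnd D h" by (simp add: label_def nat_mod_as_int)
    then show ?thesis using h(2) sgnd_cong_cases[of D h] by (metis minus_minus)
  qed
qed

lemma label_nat: "m < N \<Longrightarrow> label D b (int m) = sgnd D (b m)"
  by (simp add: label_def)

definition signed_sum :: "int set \<Rightarrow> int" where "signed_sum D = (\<Sum>h\<in>H. sgnd D h)"

text \<open>The sum of the labels depends on the signs only, so conditions on it survive every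
  rearrangement of the positions.\<close>

lemma sum_label:
  assumes "bij_betw b {..<N} H"
  shows "(\<Sum>l<N. label D b (int l)) = signed_sum D"
proof -
  have "(\<Sum>l<N. label D b (int l)) = (\<Sum>l<N. sgnd D (b l))" by (simp add: label_nat)
  also have "\<dots> = signed_sum D"
    unfolding signed_sum_def by (rule sum.reindex_bij_betw[OF assms])
  finally show ?thesis .
qed

text \<open>The factor 6 keeps the sum itself, its double and its triple outside J at once.\<close>

definition good :: "int set \<Rightarrow> bool" where "good D \<longleftrightarrow> \<not> int w dvd 6 * signed_sum D"

text \<open>
  Changing the sign of \<open>2\<close> changes \<open>6 * signed_sum D\<close> by \<open>24\<close>, which is not in \<open>J\<close> as \<open>w > 24\<close>.
\<close>

definition adjust :: "int set \<Rightarrow> int set" where "adjust D = (if good D then D else insert 2 D)"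

lemma good_adjust:
  assumes "2 \<notin> D"
  shows "good (adjust D)"
proof (cases "good D")
  case False
  have "signed_sum (insert 2 D) = signed_sum D - 4"
  proof -
    have "sgnd (insert 2 D) h = sgnd D h - (if h = 2 then 4 else 0)" for h
      using assms by (simp add: sgnd_def)
    then have "signed_sum (insert 2 D) = signed_sum D - (\<Sum>h\<in>H. if h = 2 then 4 else 0)"
      by (simp add: signed_sum_def sum_subtractf)
    then show ?thesis using small_mem_H[of 2] finite_H by (simp add: sum.delta)
  qed
  then have e: "6 * signed_sum (insert 2 D) = 6 * signed_sum D - 24" by simp
  have "\<not> int w dvd 6 * signed_sum (insert 2 D)"
  proof
    assume "int w dvd 6 * signed_sum (insert 2 D)"
    moreover have "int w dvd 6 * signed_sum D" using False by (simp add: good_def)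
    ultimately have "int w dvd 6 * signed_sum D - 6 * signed_sum (insert 2 D)" by (rule dvd_diff[rotated])
    then have "int w dvd 24" using e by simp
    then have "int w \<le> 24" by (rule zdvd_imp_le) simp
    then show False using w_gt by simp
  qed
  then show ?thesis using False by (simp add: adjust_def good_def)
qed (simp add: adjust_def)

text \<open>Positions 0 and 1 receive the representatives in \<open>H\<close> of the sum and of its
  double. These differ, as otherwise \<open>v\<close> would divide the sum or its triple. Positions
  2 and 3 receive two other elements of 1 to 4, whose signed difference is nonzero and at most
  \<open>8 < w\<close> in absolute value.\<close>

lemma ex_base_bijection:
  assumes "good D"
  shows "\<exists>b. bij_betw b {..<N} H \<and>
    (\<exists>a. [sgnd D (b 0) = a * signed_sum D] (mod int v)) \<and> (\<exists>a. [sgnd D (b 1) = a * signed_sum D] (mod int v)) \<and>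
    \<not> int w dvd sgnd D (b 2) - sgnd D (b 3)"
proof -
  have mult: "\<not> int w dvd c * signed_sum D" if "c dvd 6" for c
    using assms that by (metis good_def dvd_mult2 dvd_trans mult_dvd_mono dvd_refl)
  have n1: "\<not> int w dvd signed_sum D" using mult[of 1] by simp
  have n2: "\<not> int w dvd 2 * signed_sum D" using mult[of 2] by simp
  have n3: "\<not> int w dvd 3 * signed_sum D" using mult[of 3] by simp
  obtain h1 where h1: "h1 \<in> H" "[signed_sum D = h1] (mod int v) \<or> [signed_sum D = - h1] (mod int v)"
    using H_repr[OF n1] by blast
  obtain h2 where h2: "h2 \<in> H" "[2 * signed_sum D = h2] (mod int v) \<or> [2 * signed_sum D = - h2] (mod int v)"
    using H_repr[OF n2] by blast
  have "h1 \<noteq> h2"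
  proof
    assume "h1 = h2"
    then have "int v dvd 2 * signed_sum D - signed_sum D \<or> int v dvd 2 * signed_sum D + signed_sum D"
      using h1(2) h2(2) by (smt (verit) cong_iff_dvd_diff dvd_add dvd_diff)
    then have "int v dvd signed_sum D \<or> int v dvd 3 * signed_sum D" by (simp add: algebra_simps)
    then show False using n1 n3 w_dvd_v dvd_trans by blast
  qed
  have "card ({1, 2, 3, 4 :: int} - {h1, h2}) \<ge> 4 - card {h1, h2}"
    using diff_card_le_card_Diff[of "{h1, h2}" "{1, 2, 3, 4}"] by simp
  then have "card ({1, 2, 3, 4 :: int} - {h1, h2}) \<ge> 2"
    using card_insert_le_m1[of 2 "{h2}" h1] \<open>h1 \<noteq> h2\<close> by simp
  then obtain x y where xy: "x \<in> {1, 2, 3, 4} - {h1, h2}" "y \<in> {1, 2, 3, 4} - {h1, h2}" "x \<noteq> y"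
    by (metis card_le_Suc0_iff_eq finite_Diff finite.emptyI finite.insertI not_less_eq_eq numeral_2_eq_2)
  have xyH: "x \<in> H" "y \<in> H" using xy by (auto intro: small_mem_H)
  have "distinct [h1, h2, x, y]" "set [h1, h2, x, y] \<subseteq> H" using xy \<open>h1 \<noteq> h2\<close> xyH h1 h2 by auto
  from ex_bij_betw_extending_list[OF finite_H this] obtain b where b: "bij_betw b {..<N} H"
    and b4: "\<forall>i < length [h1, h2, x, y]. b i = [h1, h2, x, y] ! i" unfolding card_H by blast
  have vals: "b 0 = h1" "b 1 = h2" "b 2 = x" "b 3 = y"
    using b4[THEN spec, of 0] b4[THEN spec, of 1] b4[THEN spec, of 2] b4[THEN spec, of 3]
    by (simp_all add: numeral_2_eq_2 numeral_3_eq_3)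
  have signs: "\<exists>a. [sgnd D h = a * z] (mod int v)"
    if "[c * z = h] (mod int v) \<or> [c * z = - h] (mod int v)" for h z c :: int
  proof -
    from that have "[h = c * z] (mod int v) \<or> [- h = c * z] (mod int v)" using cong_sym by blast
    then have "[h = c * z] (mod int v) \<and> [- h = - c * z] (mod int v) \<or>
        [h = - c * z] (mod int v) \<and> [- h = c * z] (mod int v)"
      by (metis cong_minus_minus_iff minus_minus mult_minus_left)
    then show ?thesis using sgnd_cong_cases[of D h] by metis
  qed
  have "\<exists>a. [sgnd D (b 0) = a * signed_sum D] (mod int v)" using signs[of 1 "signed_sum D" h1] h1 vals by simp
  moreover have "\<exists>a. [sgnd D (b 1) = a * signed_sum D] (mod int v)" using signs[of 2 "signed_sum D" h2] h2 vals by simp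
  moreover have "\<not> int w dvd sgnd D (b 2) - sgnd D (b 3)"
  proof
    assume d: "int w dvd sgnd D (b 2) - sgnd D (b 3)"
    have "sgnd D x \<noteq> sgnd D y" using sgnd_inj xyH xy(3) by blast
    moreover have "\<bar>sgnd D x - sgnd D y\<bar> \<le> \<bar>x\<bar> + \<bar>y\<bar>"
      using abs_sgnd[of D x] abs_sgnd[of D y] by linarith
    moreover have "\<bar>x\<bar> + \<bar>y\<bar> \<le> 8" using xy by auto
    ultimately show False using d w_gt zdvd_not_zless[of "\<bar>sgnd D x - sgnd D y\<bar>" "int w"] vals by force
  qed
  ultimately show ?thesis using b by blast
qed

end

subsection \<open>Counting\<close>

text \<open>Even powers of the rotation at 0 list the labels in a fixed order. Once a common label
  provides a common starting arc, the two lists run in parallel.\<close>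

lemma cyclic_labelling_rot_eq_imp_shift:
  assumes f: "cyclic_labelling v w t N j f" and f': "cyclic_labelling v w t N j f'"
    and rot: "cyclic_labelling.rot v j f = cyclic_labelling.rot v j f'"
    and i: "f i = f' i'"
  shows "[f m = f' (m + (i' - i))] (mod int v)"
proof -
  interpret L: cyclic_labelling v w t N j f by (rule f)
  interpret L': cyclic_labelling v w t N j f' by (rule f')
  have A: "L.A 0 i = L'.A 0 i'" by (simp add: L.A_def L'.A_def i)
  obtain l where l: "[i + int l * (1 + int j) = m] (mod int N)" using L.ex_multiple by blast
  have "(L.rot ^^ (2 * l)) (L.A 0 i) = (L'.rot ^^ (2 * l)) (L'.A 0 i')" by (simp only: rot A)
  then have "L.A 0 (i + int l * (1 + int j)) = L'.A 0 (i' + int l * (1 + int j))"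
    by (simp only: L.rot_funpow_A L'.rot_funpow_A)
  then have "[f (i + int l * (1 + int j)) = f' (i' + int l * (1 + int j))] (mod int v)"
    by (simp add: L.A_def L'.A_def cong_def)
  moreover have "f (i + int l * (1 + int j)) = f m" by (rule L.f_cong[OF l])
  moreover have "f' (i' + int l * (1 + int j)) = f' (m + (i' - i))"
  proof (rule L'.f_cong)
    have "[i + int l * (1 + int j) + (i' - i) = m + (i' - i)] (mod int N)"
      using l by (simp only: cong_add_rcancel)
    then show "[i' + int l * (1 + int j) = m + (i' - i)] (mod int N)" by (simp add: algebra_simps)
  qed
  ultimately show ?thesis by simp
qed

lemma card_multiples:
  assumes "k > 0"
  shows "card {l. l < n * k \<and> k dvd l} = (n :: nat)"
proof -
  have "{l. l < n * k \<and> k dvd l} = (\<lambda>i. k * i) ` {..<n}"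
    using assms by (auto elim!: dvdE simp: mult.commute)
  moreover have "inj_on (\<lambda>i. k * i) {..<n}" using assms by (auto intro!: inj_onI)
  ultimately show ?thesis by (simp add: card_image)
qed

text \<open>The positions modulo \<open>N\<close> form \<open>n\<close> rows, the residue classes
  modulo \<open>n\<close>. As \<open>m0\<close> is coprime to \<open>k\<close>, each row is a single
  cycle of length \<open>k\<close> under \<open>i \<mapsto> i + n * m0\<close>. By
  \<open>n_gt_1\<close> positions 2 and 3 lie in different rows.\<close>

locale half_system_array = half_system +
  fixes n k m0 :: nat
  assumes N_prod: "N = n * k" and n_gt_1: "n > 1" and k_pos: "k > 0"
    and coprime_m0: "coprime m0 k" and coprime_j: "coprime (1 + n * m0) N"
begin

abbreviation j :: nat where "j \<equiv> n * m0"

lemma dvd_j_mult_iff: "N dvd j * m \<longleftrightarrow> k dvd m"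
proof -
  have "N dvd j * m \<longleftrightarrow> n * k dvd n * (m0 * m)" by (simp add: N_prod mult.assoc)
  also have "\<dots> \<longleftrightarrow> k dvd m0 * m" using n_gt_1 by simp
  also have "\<dots> \<longleftrightarrow> k dvd m" using coprime_m0 by (simp add: coprime_commute coprime_dvd_mult_right_iff)
  finally show ?thesis .
qed

text \<open>In \<open>N\<close> steps the row of \<open>a\<close> is traversed \<open>n\<close>
  times, and \<open>d\<close> can be nonzero in that row only at \<open>a\<close>.\<close>

lemma sum_along_row:
  assumes per: "\<And>i. d (i mod int N) = d i"
    and supp: "\<And>i. d i \<noteq> 0 \<Longrightarrow> [i = a] (mod int n) \<Longrightarrow> [i = a] (mod int N)"
  shows "(\<Sum>l<N. d (a + int j * int l)) = int n * d a"
proof -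
  have "d (a + int j * int l) = (if k dvd l then d a else 0)" for l
  proof (cases "k dvd l")
    case True
    then have "int N dvd int (j * l)" using dvd_j_mult_iff by (simp only: int_dvd_int_iff)
    then have "(a + int j * int l) mod int N = a mod int N"
      by (metis add.right_neutral dvd_imp_mod_0 mod_add_right_eq of_nat_mult)
    then show ?thesis using True per by metis
  next
    case False
    have "[a + int j * int l = a] (mod int n)" by (simp add: cong_iff_dvd_diff)
    moreover have "\<not> [a + int j * int l = a] (mod int N)"
    proof
      assume "[a + int j * int l = a] (mod int N)"
      then have "int N dvd int (j * l)" by (simp add: cong_iff_dvd_diff)
      then show False using False dvd_j_mult_iff by (simp only: int_dvd_int_iff)
    qed
    ultimately show ?thesis using supp False by auto
  qed
  then have "(\<Sum>l<N. d (a + int j * int l)) = (\<Sum>l<N. if k dvd l then d a else 0)" by simp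
  also have "\<dots> = (\<Sum>l | l \<in> {..<N} \<and> k dvd l. d a)" by (rule sum.inter_filter[symmetric]) simp
  also have "\<dots> = int n * d a" using card_multiples[OF k_pos, of n] by (simp add: N_prod)
  finally show ?thesis .
qed

text \<open>The quantity \<open>S\<close> of the labelling; every entry of the row of
  \<open>i\<close> is counted \<open>n\<close> times.\<close>

definition row_sum :: "int set \<Rightarrow> (nat \<Rightarrow> int) \<Rightarrow> int \<Rightarrow> int" where
  "row_sum D b i = (\<Sum>l<N. label D b (i + int j * int l))"

text \<open>
  Exchanging the labels in positions \<open>2\<close> and \<open>3\<close>, which lie in different rows, changes the difference
  of the row sums by \<open>2 * n * z\<close>, where \<open>z\<close> is the difference of the labels. As \<open>n\<close> divides \<open>N\<close> and
  \<open>2 * N = v - t\<close>, this vanishes modulo \<open>v\<close> only if \<open>t * z\<close> does, that is, only if \<open>z\<close> is in \<open>J\<close>.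
\<close>

lemma row_sums_after_swap:
  assumes b: "\<not> int w dvd sgnd D (b 2) - sgnd D (b 3)"
    and eq: "[row_sum D b 2 = row_sum D b 3] (mod int v)"
  shows "\<not> [row_sum D (b \<circ> transpose 2 3) 2 = row_sum D (b \<circ> transpose 2 3) 3] (mod int v)"
proof
  let ?b = "b \<circ> transpose 2 3"
  let ?z = "sgnd D (b 3) - sgnd D (b 2)"
  define d where "d i = label D ?b i - label D b i" for i
  have N3: "N > 3" using N_ge by simp
  have d2: "d 2 = ?z" and d3: "d 3 = - ?z"
    using N3 by (simp_all add: d_def label_def)
  have d_out: "i mod int N = 2 \<or> i mod int N = 3" if "d i \<noteq> 0" for i
  proof (rule ccontr)
    assume *: "\<not> (i mod int N = 2 \<or> i mod int N = 3)"
    then have "nat (i mod int N) \<noteq> 2" "nat (i mod int N) \<noteq> 3" by (auto simp: nat_eq_iff)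
    then have "d i = 0" by (simp add: d_def label_def transpose_apply_other)
    then show False using that by simp
  qed
  have nN: "int n dvd int N" by (simp add: N_prod)
  have not32: "\<not> [3 = 2] (mod int n)" "\<not> [2 = 3] (mod int n)"
    using n_gt_1 by (auto simp: cong_iff_dvd_diff)
  have supp: "[i = a] (mod int N)" if "a = 2 \<or> a = 3" "d i \<noteq> 0" "[i = a] (mod int n)" for i a :: int
  proof -
    have "[i = 2] (mod int N) \<or> [i = 3] (mod int N)"
      using d_out[OF that(2)] N3 by (auto simp: cong_def)
    moreover have "[i = c] (mod int n)" if "[i = c] (mod int N)" for c
      using that nN by (rule cong_dvd_modulus)
    ultimately show ?thesis using that not32 by (metis cong_sym cong_trans)
  qed
  have per: "d (i mod int N) = d i" for i by (simp add: d_def label_def)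
  have diff: "row_sum D ?b a = row_sum D b a + int n * d a" if "a = 2 \<or> a = 3" for a
  proof -
    have "(\<Sum>l<N. d (a + int j * int l)) = int n * d a"
      by (rule sum_along_row, rule per, rule supp[OF that])
    then show ?thesis by (simp add: row_sum_def d_def sum_subtractf)
  qed
  assume "[row_sum D ?b 2 = row_sum D ?b 3] (mod int v)"
  then have "int v dvd row_sum D ?b 2 - row_sum D ?b 3" by (simp only: cong_iff_dvd_diff)
  moreover have "int v dvd row_sum D b 2 - row_sum D b 3" using eq by (simp only: cong_iff_dvd_diff)
  ultimately have "int v dvd (row_sum D ?b 2 - row_sum D ?b 3) - (row_sum D b 2 - row_sum D b 3)"
    by (rule dvd_diff)
  also have "\<dots> = 2 * int n * ?z"
    using diff[of 2] diff[of 3] by (simp add: d2 d3 algebra_simps)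
  finally have "int v dvd 2 * int n * ?z" .
  then have "int v dvd 2 * int n * ?z * int k" by (rule dvd_mult2)
  then have "int v dvd 2 * int N * ?z" by (simp add: N_prod algebra_simps)
  then have "int v dvd (int v - int t) * ?z" by (simp only: v_minus_t)
  moreover have "int v dvd int v * ?z" by simp
  ultimately have "int v dvd int v * ?z - (int v - int t) * ?z" by (rule dvd_diff[rotated])
  then have "int v dvd ?z * int t" by (simp add: algebra_simps)
  then have "int w * int t dvd ?z * int t" by (simp add: v_eq)
  then have "int w dvd ?z" using t_pos by simp
  then show False using b by (simp add: dvd_diff_commute)
qed

lemma cyclic_biembedding_of_label:
  assumes b: "bij_betw b {..<N} H"
    and b0: "\<exists>a. [sgnd D (b 0) = a * signed_sum D] (mod int v)"
    and b1: "\<exists>a. [sgnd D (b 1) = a * signed_sum D] (mod int v)"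
    and uneven: "\<not> [row_sum D b 2 = row_sum D b 3] (mod int v)"
  shows "(complete_multipartite v t, cyclic_labelling.rot v j (label D b)) \<in> cyclic_biembeddings v t k"
proof -
  interpret L: cyclic_labelling v w t N j "label D b"
    by (rule cyclic_labelling_label[OF b coprime_j])
  have s: "L.s = signed_sum D" using sum_label[OF b] by (simp add: L.s_def)
  have S: "L.S = row_sum D b" by (simp add: fun_eq_iff L.S_def row_sum_def)
  have l0: "label D b 0 = sgnd D (b 0)" and l1: "label D b 1 = sgnd D (b 1)"
    using N_ge by (simp_all add: label_def)
  obtain a0 a1 where "[label D b 0 = a0 * L.s] (mod int v)" "[label D b 1 = a1 * L.s] (mod int v)"
    using b0 b1 unfolding s l0 l1 by blast
  then have "Aut (L.\<Gamma>, L.rot) = translation v ` Zmod v"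
    by (rule L.Aut_rot) (use uneven S in simp)
  moreover have "k dvd face_length F" if "F \<in> faces (L.\<Gamma>, L.rot)" for F
  proof (rule L.dvd_face_length[OF _ _ that])
    show "k dvd m" if "N dvd j * m" for m using that dvd_j_mult_iff by blast
    show "k dvd N" by (simp add: N_prod)
  qed
  ultimately show ?thesis
    using L.biembedding_rot unfolding cyclic_biembeddings_def by simp
qed

text \<open>The family is indexed by the signs on \<open>H - {1, 2}\<close> and the permutations of
  the positions from 4 on. The label 1 stays positive as an anchor for comparing rotations, and the
  sign of 2 is reserved for \<open>adjust\<close>.\<close>

lemma card_cyclic_biembeddings_ge:
  "2 ^ (N - 2) * fact (N - 4) \<le> card (cyclic_biembeddings v t k)"
proof -
  obtain \<beta> where \<beta>: "\<And>D. good D \<Longrightarrow> bij_betw (\<beta> D) {..<N} H \<and>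
    (\<exists>a. [sgnd D (\<beta> D 0) = a * signed_sum D] (mod int v)) \<and>
    (\<exists>a. [sgnd D (\<beta> D 1) = a * signed_sum D] (mod int v)) \<and>
    \<not> int w dvd sgnd D (\<beta> D 2) - sgnd D (\<beta> D 3)"
    using ex_base_bijection by metis
  define I where "I = Pow (H - {1, 2}) \<times> {p. p permutes {4..<N}}"
  define base where "base D p = \<beta> (adjust D) \<circ> p" for D and p :: "nat \<Rightarrow> nat"
  \<comment> \<open>If the row sums of positions 2 and 3 agree, exchanging these labels separates
    them, and all other positions are untouched.\<close>
  define b where "b D p = (if [row_sum (adjust D) (base D p) 2 = row_sum (adjust D) (base D p) 3] (mod int v)
    then base D p \<circ> transpose 2 3 else base D p)" for D p
  define lab where "lab D p = label (adjust D) (b D p)" for D p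
  define emb where "emb D p = cyclic_labelling.rot v j (lab D p)" for D p
  have N4: "N > 4" using N_ge by simp
  have b_bij: "bij_betw (b D p) {..<N} H" and b_0: "b D p 0 = \<beta> (adjust D) 0"
    and b_1: "b D p 1 = \<beta> (adjust D) 1"
    and b_rest: "\<And>i. i \<in> {4..<N} \<Longrightarrow> b D p i = \<beta> (adjust D) (p i)"
    and mem: "(complete_multipartite v t, emb D p) \<in> cyclic_biembeddings v t k"
    if "(D, p) \<in> I" for D p
  proof -
    have D: "2 \<notin> D" and p: "p permutes {4..<N}" using that by (auto simp: I_def)
    have good: "good (adjust D)" by (rule good_adjust[OF D])
    have fix_p: "p 0 = 0" "p 1 = 1" "p 2 = 2" "p 3 = 3"
      using p by (simp_all add: permutes_def)
    have "p permutes {..<N}" by (rule permutes_subset[OF p]) auto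
    then have bij_base: "bij_betw (base D p) {..<N} H"
      unfolding base_def using \<beta>[OF good] by (intro bij_betw_trans[OF permutes_imp_bij]) auto
    have "bij_betw (transpose 2 3 :: nat \<Rightarrow> nat) {..<N} {..<N}"
      by (rule permutes_imp_bij, rule permutes_swap_id) (use N4 in auto)
    then have "bij_betw (base D p \<circ> transpose 2 3) {..<N} H" by (rule bij_betw_trans[OF _ bij_base])
    then show bij: "bij_betw (b D p) {..<N} H" using bij_base by (simp add: b_def)
    show 0: "b D p 0 = \<beta> (adjust D) 0" and 1: "b D p 1 = \<beta> (adjust D) 1"
      using fix_p by (simp_all add: b_def base_def)
    show "b D p i = \<beta> (adjust D) (p i)" if "i \<in> {4..<N}" for i
      using that by (simp add: b_def base_def transpose_apply_other)
    have "\<not> [row_sum (adjust D) (b D p) 2 = row_sum (adjust D) (b D p) 3] (mod int v)"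
    proof (cases "[row_sum (adjust D) (base D p) 2 = row_sum (adjust D) (base D p) 3] (mod int v)")
      case True
      have "\<not> int w dvd sgnd (adjust D) (base D p 2) - sgnd (adjust D) (base D p 3)"
        using \<beta>[OF good] fix_p by (simp add: base_def)
      from row_sums_after_swap[OF this True] show ?thesis using True by (simp add: b_def)
    qed (simp add: b_def)
    then show "(complete_multipartite v t, emb D p) \<in> cyclic_biembeddings v t k"
      unfolding emb_def lab_def using \<beta>[OF good] 0 1
      by (intro cyclic_biembedding_of_label[OF bij]) simp_all
  qed
  have "inj_on (\<lambda>(D, p). (complete_multipartite v t, emb D p)) I"
  proof (rule inj_onI, clarify)
    fix D p D' p'
    assume Dp: "(D, p) \<in> I" and Dp': "(D', p') \<in> I" and eq: "emb D p = emb D' p'"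
    have cop: "coprime (1 + j) N" by (rule coprime_j)
    note L = cyclic_labelling_label[OF b_bij[OF Dp] cop, of "adjust D", folded lab_def]
    note L' = cyclic_labelling_label[OF b_bij[OF Dp'] cop, of "adjust D'", folded lab_def]
    have D: "D \<subseteq> H - {1, 2}" and D': "D' \<subseteq> H - {1, 2}"
      and p: "p permutes {4..<N}" and p': "p' permutes {4..<N}"
      using Dp Dp' by (auto simp: I_def)
    have lab_val: "lab D p (int m) = sgnd (adjust D) (b D p m)" if "m < N" for m D p
      using that by (simp add: lab_def label_nat)
    have lab_mem: "\<exists>h \<in> H. lab D p i = sgnd (adjust D) h" if "(D, p) \<in> I" for D p i
    proof -
      have "nat (i mod int N) < N" using N4 by (simp add: nat_less_iff)
      then have "b D p (nat (i mod int N)) \<in> H" using b_bij[OF that] bij_betwE by blast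
      then show ?thesis by (auto simp: lab_def label_def)
    qed
    have lab_small: "2 * \<bar>lab D p i\<bar> < int v" if "(D, p) \<in> I" for D p i
      using lab_mem[OF that, of i] H_bounds(2) by auto
    have lab_surj: "\<exists>m < N. lab D p (int m) = sgnd (adjust D) h" if in_I: "(D, p) \<in> I" and h: "h \<in> H" for D p h
    proof -
      obtain m where "m < N" "b D p m = h"
        using b_bij[OF in_I] h by (metis bij_betw_imp_surj_on imageE lessThan_iff)
      then show ?thesis using lab_val by blast
    qed
    \<comment> \<open>The label 1 occurs in both labellings, so equal rotations make them cyclic
      shifts of each other.\<close>
    have one: "\<exists>i. lab D p i = 1" if "(D, p) \<in> I" for D p
    proof -
      have "1 \<notin> adjust D" using that by (auto simp: I_def adjust_def)
      then have "sgnd (adjust D) 1 = 1" by (simp add: sgnd_def)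
      then show ?thesis using lab_surj[OF that, of 1] small_mem_H[of 1] by auto
    qed
    obtain i i' where "lab D p i = 1" "lab D' p' i' = 1" using one[OF Dp] one[OF Dp'] by blast
    then have i: "lab D p i = lab D' p' i'" by simp
    define c where "c = i' - i"
    have shift: "lab D p m = lab D' p' (m + c)" for m
      by (rule small_cong_imp_eq[OF _ lab_small[OF Dp] lab_small[OF Dp']])
        (use cyclic_labelling_rot_eq_imp_shift[OF L L' eq[unfolded emb_def] i] in \<open>simp add: c_def\<close>)
    have range_eq: "range (lab D p) = range (lab D' p')"
    proof
      show "range (lab D p) \<subseteq> range (lab D' p')" using shift by auto
      show "range (lab D' p') \<subseteq> range (lab D p)"
      proof clarify
        fix m show "lab D' p' m \<in> range (lab D p)" using shift[of "m - c"] by (metis diff_add_cancel rangeI)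
      qed
    qed
    \<comment> \<open>The negated elements can be read off the set of labels, which a shift does not
      change.\<close>
    have recover: "adjust D = {h \<in> H. - h \<in> range (lab D p)}" if in_I: "(D, p) \<in> I" for D p
    proof (intro set_eqI iffI)
      fix h assume h: "h \<in> adjust D"
      have "D \<subseteq> H" using that by (auto simp: I_def)
      then have hH: "h \<in> H" using h small_mem_H[of 2] by (auto simp: adjust_def split: if_splits)
      obtain m where "lab D p (int m) = sgnd (adjust D) h" using lab_surj[OF in_I hH] by blast
      then have "lab D p (int m) = - h" using h by (simp add: sgnd_def)
      then show "h \<in> {h \<in> H. - h \<in> range (lab D p)}" using hH by (metis (mono_tags) mem_Collect_eq rangeI)
    next
      fix h assume "h \<in> {h \<in> H. - h \<in> range (lab D p)}"
      then obtain m where h: "h \<in> H" "- h = lab D p m" by auto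
      then obtain h' where h': "h' \<in> H" "- h = sgnd (adjust D) h'" using lab_mem[OF in_I, of m] by auto
      then have "\<bar>h'\<bar> = \<bar>h\<bar>" using abs_sgnd by (metis abs_minus_cancel)
      then have "h' = h" using H_bounds(1)[OF h(1)] H_bounds(1)[OF h'(1)] by linarith
      then show "h \<in> adjust D" using h' H_bounds(1)[OF h(1)] by (auto simp: sgnd_def split: if_splits)
    qed
    have adj: "adjust D = adjust D'" using recover[OF Dp] recover[OF Dp'] range_eq by simp
    \<comment> \<open>\<open>adjust\<close> can add only 2, which belongs to neither
      \<open>D\<close> nor \<open>D'\<close>.\<close>
    have "D = adjust D - {2}" "D' = adjust D' - {2}" using D D' by (auto simp: adjust_def)
    then have DD': "D = D'" using adj by simp
    \<comment> \<open>Position 0 carries the same label in both labellings, as this label depends on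
      \<open>adjust D\<close> alone; so the shift is trivial.\<close>
    have "lab D' p' c = lab D p 0" using shift[of 0] by simp
    also have "\<dots> = lab D' p' 0"
      using lab_val[of 0] N4 b_0[OF Dp] b_0[OF Dp'] adj by simp
    finally have "[lab D' p' c = lab D' p' 0] (mod int v)" by simp
    then have c0: "[c = 0] (mod int N)" by (rule cyclic_labelling.inj[OF L'])
    have same: "lab D p m = lab D' p' m" for m
    proof -
      have "[m + c = m + 0] (mod int N)" using c0 by (simp only: cong_add_lcancel)
      then have "lab D' p' (m + c) = lab D' p' (m + 0)" by (rule cyclic_labelling.f_cong[OF L'])
      then show ?thesis using shift by simp
    qed
    have "p i = p' i" for i
    proof (cases "i \<in> {4..<N}")
      case True
      then have iN: "i < N" by simp
      have pi: "p i < N" "p' i < N" using True permutes_in_image[OF p, of i] permutes_in_image[OF p', of i] by auto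
      have good: "good (adjust D)" using D by (intro good_adjust) auto
      then have bij: "bij_betw (\<beta> (adjust D)) {..<N} H" using \<beta> by blast
      have "sgnd (adjust D) (\<beta> (adjust D) (p i)) = sgnd (adjust D) (\<beta> (adjust D) (p' i))"
        using same[of "int i"] lab_val[OF iN] b_rest[OF Dp True] b_rest[OF Dp' True] adj by simp
      then have "\<beta> (adjust D) (p i) = \<beta> (adjust D) (p' i)"
        by (rule sgnd_inj[rotated 2]) (use bij pi bij_betwE in blast)+
      then show ?thesis using bij pi by (metis bij_betw_def inj_onD lessThan_iff)
    next
      case False
      then show ?thesis using p p' by (simp add: permutes_def)
    qed
    then show "D = D' \<and> p = p'" using DD' by auto
  qed
  then have "card I \<le> card (cyclic_biembeddings v t k)"
    by (rule card_inj_on_le) (use mem finite_cyclic_biembeddings in auto)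
  moreover have "card I = 2 ^ (N - 2) * fact (N - 4)"
  proof -
    have "card (H - {1, 2}) = N - 2"
      using small_mem_H[of 1] small_mem_H[of 2] finite_H card_H by (simp add: card_Diff_subset)
    then have "card (Pow (H - {1, 2})) = 2 ^ (N - 2)" using finite_H by (simp add: card_Pow)
    moreover have "card {p. p permutes {4..<N}} = fact (N - 4)"
      by (rule card_permutations) simp_all
    ultimately show ?thesis unfolding I_def by (simp add: card_cartesian_product)
  qed
  ultimately show ?thesis by simp
qed

end

section \<open>Elementary estimates and the choice of the multiplier \<open>m0\<close>\<close>

lemma fact_le_power_fact:
  assumes "N \<ge> 20"
  shows "fact N \<le> 2 ^ (N - 2) * (fact (N - 4) :: nat)"
proof -
  \<comment> \<open>The induction starts from \<open>20 ^ 4 = 160000\<close> and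
    \<open>2 ^ 18 = 262144\<close>; for \<open>x \<ge> 20\<close> the step from \<open>x\<close> to
    \<open>x + 1\<close> at most doubles the fourth power.\<close>
  have pow: "(m + 20) ^ 4 \<le> 2 ^ (m + 18)" for m :: nat
  proof (induction m)
    case (Suc m)
    have e: "(x + 1) ^ 4 = x ^ 4 + 4 * x ^ 3 + 6 * x ^ 2 + 4 * x + 1" for x :: nat
      by (simp add: power4_eq_xxxx power3_eq_cube power2_eq_square algebra_simps)
    define x where "x = m + 20"
    have x: "x \<ge> 20" by (simp add: x_def)
    have "20 * x ^ 3 \<le> x * x ^ 3" "20 * x ^ 2 \<le> x * x ^ 2" "20 * x \<le> x * x" using x by simp_all
    then have "20 * x ^ 3 \<le> x ^ 4" "20 * x ^ 2 \<le> x ^ 3" "20 * x \<le> x ^ 2"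
      by (simp_all add: power4_eq_xxxx power3_eq_cube power2_eq_square algebra_simps)
    then have "(x + 1) ^ 4 \<le> 2 * x ^ 4" unfolding e using x by linarith
    also have "\<dots> \<le> 2 * 2 ^ (m + 18)" using Suc by (simp add: x_def)
    also have "\<dots> = 2 ^ (Suc m + 18)" by (simp only: add_Suc power_Suc)
    also have "x + 1 = Suc m + 20" by (simp add: x_def)
    finally show ?case .
  qed simp
  define M where "M = N - 4"
  have N: "N = M + 4" using assms by (simp add: M_def)
  have "fact N = (M + 4) * (M + 3) * (M + 2) * (M + 1) * (fact M :: nat)"
    by (simp add: N numeral_eq_Suc algebra_simps)
  also have "\<dots> \<le> N * N * N * N * fact M"
    unfolding N by (intro mult_le_mono) simp_all
  also have "\<dots> = N ^ 4 * fact M" by (simp add: power4_eq_xxxx)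
  also have "\<dots> \<le> 2 ^ (N - 2) * fact M"
  proof -
    have "N = (N - 20) + 20" "N - 2 = (N - 20) + 18" using assms by simp_all
    then have "N ^ 4 \<le> 2 ^ (N - 2)" using pow[of "N - 20"] by metis
    then show ?thesis by simp
  qed
  finally show ?thesis by (simp add: N)
qed

text \<open>By the Chinese remainder theorem it suffices to treat each prime \<open>q\<close>
  dividing \<open>k\<close>. The residue 1 works unless \<open>q\<close> divides
  \<open>n + 1\<close>; then 2 works, as \<open>q\<close> is odd and \<open>2 * n + 1\<close> is
  \<open>- 1\<close> modulo \<open>q\<close>.\<close>

lemma ex_coprime_shift:
  fixes n k :: nat
  assumes "odd k" "k > 0"
  shows "\<exists>m. coprime m k \<and> coprime (n * m + 1) k"
proof -
  let ?P = "prime_factors k"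
  have "\<exists>x. \<forall>q \<in> ?P. [x = (if q dvd n + 1 then 2 else 1)] (mod id q)"
    by (rule chinese_remainder_nat) (auto intro: primes_coprime)
  then obtain m where m: "\<And>q. q \<in> ?P \<Longrightarrow> [m = (if q dvd n + 1 then 2 else 1)] (mod q)"
    unfolding id_apply by blast
  have key: "\<not> q dvd m \<and> \<not> q dvd n * m + 1" if "prime q" "q dvd k" for q
  proof -
    have qP: "q \<in> ?P" using that assms by (simp add: prime_factors_dvd)
    have "q \<noteq> 2" using that assms by auto
    then have "q > 2" using prime_ge_2_nat[OF that(1)] by linarith
    then have q2: "\<not> q dvd 1" "\<not> q dvd 2" by (auto dest: dvd_imp_le)
    show ?thesis
    proof (cases "q dvd n + 1")
      case True
      then have m2: "[m = 2] (mod q)" using m[OF qP] by simp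
      then have "[n * m + 1 = n * 2 + 1] (mod q)" by (intro cong_add cong_mult cong_refl)
      moreover have "\<not> q dvd n * 2 + 1"
      proof
        assume "q dvd n * 2 + 1"
        moreover have "q dvd (n + 1) * 2" using True by (rule dvd_mult2)
        ultimately have "q dvd (n + 1) * 2 - (n * 2 + 1)" by (rule dvd_diff_nat[rotated])
        then show False using q2 by simp
      qed
      ultimately show ?thesis using m2 q2 cong_dvd_iff by blast
    next
      case False
      then have m1: "[m = 1] (mod q)" using m[OF qP] by simp
      then have "[n * m + 1 = n * 1 + 1] (mod q)" by (intro cong_add cong_mult cong_refl)
      then show ?thesis using m1 q2 False cong_dvd_iff by fastforce
    qed
  qed
  have "coprime a k" if a: "\<And>q. prime q \<Longrightarrow> q dvd k \<Longrightarrow> \<not> q dvd a" for a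
  proof (rule ccontr)
    assume "\<not> coprime a k"
    then have "gcd a k \<noteq> 1" by (simp only: coprime_iff_gcd_eq_1 not_False_eq_True)
    then obtain q where q: "prime q" "q dvd gcd a k" using prime_factor_nat by blast
    then have "q dvd a" "q dvd k" by simp_all
    then show False using a q(1) by blast
  qed
  then have "coprime m k" "coprime (n * m + 1) k" using key by blast+
  then show ?thesis by blast
qed

section \<open>The explicit lower bound and the error term\<close>

lemma card_iso_classes_cyclic_biembeddings_ge:
  fixes t n k :: nat
  assumes t: "t > 0" "t dvd 2 * n * k" and odd: "odd (n * k)" and n: "n > 1"
    and large: "n * k \<ge> 20 + 12 * t"
  shows "fact (n * k) / (2 * real (totient (2 * n * k + t)))
    \<le> real (card (iso_classes (cyclic_biembeddings (2 * n * k + t) t k)))"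
proof -
  define N where "N = n * k"
  define v where "v = 2 * n * k + t"
  obtain q where q: "2 * n * k = t * q" using t(2) by blast
  define w where "w = q + 1"
  have "t * q = 2 * (n * k)" using q by simp
  \<comment> \<open>The threshold gives \<open>t * q \<ge> 40 + 24 * t\<close>, which is where the
    summand \<open>12 * t\<close> comes from.\<close>
  then have "t * 24 < t * q" using large t(1) by linarith
  then have "q > 24" by simp
  have "odd k" "k > 0" using odd by (auto intro: Nat.gr0I)
  then obtain m0 where m0: "coprime m0 k" "coprime (n * m0 + 1) k" using ex_coprime_shift by blast
  have "coprime (1 + n * m0) n"
    by (metis coprime_1_left coprime_commute gcd_add_mult coprime_iff_gcd_eq_1 mult.commute add.commute)
  then have cop: "coprime (1 + n * m0) N" using m0(2) by (simp add: N_def)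
  have "v = w * t" "2 * N = (w - 1) * t"
    using q by (simp_all add: v_def w_def N_def algebra_simps)
  moreover have "w > 24" "N \<ge> 20" using \<open>q > 24\<close> large by (simp_all add: w_def N_def)
  ultimately interpret half_system_array t N w v n k m0
    by (intro half_system_array.intro half_system.intro half_system_array_axioms.intro
      t(1) N_def n \<open>k > 0\<close> m0(1) cop)
  have v1: "v > 1" using v_ge_w w_gt by simp
  then have tot: "totient v > 0" by simp
  have "fact N \<le> 2 ^ (N - 2) * (fact (N - 4) :: nat)" by (rule fact_le_power_fact[OF N_ge])
  also have "\<dots> \<le> card (cyclic_biembeddings v t k)" by (rule card_cyclic_biembeddings_ge)
  also have "\<dots> \<le> card (iso_classes (cyclic_biembeddings v t k)) * (2 * totient v)"
    by (rule card_iso_classes_ge[OF v1])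
  finally have "real (fact N) \<le> real (card (iso_classes (cyclic_biembeddings v t k)) * (2 * totient v))"
    by (simp only: of_nat_le_iff)
  then have "fact N \<le> real (card (iso_classes (cyclic_biembeddings v t k))) * (2 * real (totient v))"
    by simp
  then have "fact N / (2 * real (totient v)) \<le> real (card (iso_classes (cyclic_biembeddings v t k)))"
    using tot by (simp add: divide_le_eq)
  then show ?thesis by (simp only: N_def v_def)
qed

theorem theorem5p7:
  fixes t :: nat
  assumes "t > 0" and "\<not> [t = 0] (mod 4)"
  shows "\<exists>err :: nat \<Rightarrow> nat \<Rightarrow> real.
     (\<exists>C :: real. \<forall>n k. admissible t n k \<longrightarrow> \<bar>err n k\<bar> \<le> C * (1 / real (n * k))) \<and>
     (\<forall>\<delta> > 0. \<exists>N :: nat. \<forall>n k. admissible t n k \<and> n * k \<ge> N \<longrightarrow> \<bar>err n k\<bar> < \<delta>) \<and>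
     (\<forall>n k v. admissible t n k \<and> v = 2 * n * k + t \<longrightarrow>
        real (card (iso_classes (cyclic_biembeddings v t k)))
          \<ge> (1 - err n k) * (fact (n * k) / (2 * real (totient (2 * n * k + t)))) \<and>
        (1 - err n k) * (fact (n * k) / (2 * real (totient (2 * n * k + t))))
          = (1 - err n k) * (fact ((v - t) div 2) / (2 * real (totient v))))"
proof -
  define N0 where "N0 = 20 + 12 * t"
  \<comment> \<open>Below the threshold the value 1 reduces the claim to nonnegativity of a
    cardinality; above it the bound holds without any error.\<close>
  define err :: "nat \<Rightarrow> nat \<Rightarrow> real" where "err n k = (if n * k < N0 then 1 else 0)" for n k
  show ?thesis
  proof (intro exI[of _ err] conjI)
    show "\<exists>C. \<forall>n k. admissible t n k \<longrightarrow> \<bar>err n k\<bar> \<le> C * (1 / real (n * k))"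
    \<comment> \<open>A nonzero error occurs only for \<open>n * k < N0\<close>, where
      \<open>N0 / (n * k)\<close> exceeds 1.\<close>
    proof (intro exI[of _ "real N0"] allI impI)
      fix n k assume "admissible t n k"
      then have "n * k > 0" by (simp add: admissible_def)
      then have "real (n * k) > 0" by (simp only: of_nat_0_less_iff)
      moreover have "real (n * k) \<le> real N0" if "n * k < N0"
        using that by (simp only: of_nat_le_iff less_imp_le_nat)
      ultimately show "\<bar>err n k\<bar> \<le> real N0 * (1 / real (n * k))"
        unfolding err_def by (cases "n * k < N0") (simp_all add: le_divide_eq del: of_nat_mult)
    qed
    show "\<forall>\<delta> > 0. \<exists>N. \<forall>n k. admissible t n k \<and> n * k \<ge> N \<longrightarrow> \<bar>err n k\<bar> < \<delta>"
      by (intro allI impI exI[of _ N0]) (simp add: err_def)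
    show "\<forall>n k v. admissible t n k \<and> v = 2 * n * k + t \<longrightarrow>
        real (card (iso_classes (cyclic_biembeddings v t k)))
          \<ge> (1 - err n k) * (fact (n * k) / (2 * real (totient (2 * n * k + t)))) \<and>
        (1 - err n k) * (fact (n * k) / (2 * real (totient (2 * n * k + t))))
          = (1 - err n k) * (fact ((v - t) div 2) / (2 * real (totient v)))"
    proof (intro allI impI conjI, elim conjE)
      fix n k v assume adm: "admissible t n k" and v: "v = 2 * n * k + t"
      have odd: "odd (n * k)" and n: "n > 1" and dvd: "t dvd 2 * n * k"
        using adm by (auto simp: admissible_def)
      show "real (card (iso_classes (cyclic_biembeddings v t k)))
          \<ge> (1 - err n k) * (fact (n * k) / (2 * real (totient (2 * n * k + t))))"
      proof (cases "n * k < N0")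
        case False
        then show ?thesis
          using card_iso_classes_cyclic_biembeddings_ge[OF assms(1) dvd odd n] v
          by (simp add: err_def N0_def)
      qed (simp add: err_def)
    next
      fix n k v assume "admissible t n k \<and> v = 2 * n * k + t"
      then have "(v - t) div 2 = n * k" "v = 2 * n * k + t" by auto
      then show "(1 - err n k) * (fact (n * k) / (2 * real (totient (2 * n * k + t))))
          = (1 - err n k) * (fact ((v - t) div 2) / (2 * real (totient v)))" by (simp only:)
    qed
  qed
qed

end
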